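(* Let $\lambda\in K$. The symmetrization map $\varphi$ is a morphism of current-preserving operads from $\mathcal{O}^\lambda$ to $\mathcal{B}^\lambda$; i.e. $$\varphi(S\circ_{v,\lambda}T)=\varphi(S)\diamond_{v,\lambda}\varphi(T)$$ for all finite nonempty sets $A,B$, $S\in\mathcal{O}_A$, $T\in\mathcal{O}_B$ and $v\in A$.
   Context: $K$ is a field of characteristic zero; $\mathbb{N}^*=\{1,2,3,\dots\}$ with addition; $0^0=1$. Operads are taken in species form: vector spaces $\mathcal{P}_A$ for finite nonempty sets $A$, functorial in bijections, with partial compositions $\circ_v:\mathcal{P}_A\times\mathcal{P}_B\to\mathcal{P}_{(A\setminus\{v\})\amalg B}$, $v\in A$, satisfying nested and disjoint associativity, unit and equivariance axioms. An $\mathbb{N}^*$-current-preserving operad is an operad with $\mathcal{P}_A=\prod_{W:A\to\mathbb{N}^*}\mathcal{P}_{A,W}$, with $\mathcal{P}_{A,W}.\sigma=\mathcal{P}_{A,W\circ\sigma}$ for $\sigma\in\mathrm{Aut}A$, such that $\circ_v$ maps $\mathcal{P}_{A,W}\otimes\mathcal{P}_{B,X}$ to $\mathcal{P}_{(A\setminus\{v\})\amalg B,W\amalg X}$ with image zero if $\sum_{b\in B}X(b)\neq W(v)$ (here $W\amalg X$ is $W$ on $A\setminus\{v\}$ and $X$ on $B$). A morphism of such operads is a family of linear maps respecting the components indexed by $W$, relabelling, partial compositions and units. Trees. Rooted trees are finite; a planar rooted tree is a rooted tree in which the children of each vertex are totally ordered from left to right. $B_+(r,T_1\cdots T_k)$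 is the tree with root $r$ and branches $T_1,\dots,T_k$ (unordered in the non-planar case, ordered from left to right in the planar case). A tree is labelled by $A$ via a bijection from its vertex set $v(T)$ onto $A$. A weight function is a map $W:v(T)\to\mathbb{N}^*$; $|v|=W(v)$, $|T|=\sum_vW(v)$, and the potential energy is $d(T)=\sum_vW(v)h(v)$ with $h(v)$ the number of edges from $v$ to the root. $E(S,v)$ is the set of edges joining $v$ to its children, ordered from left to right in the planar case. The operad $\mathcal{O}^\lambda$. $\mathcal{O}_{A,W}$ is spanned by non-planar rooted trees labelled by $A$ with weight function $W$, and $\mathcal{O}_A=\prod_W\mathcal{O}_{A,W}$. For weighted non-planar trees $S$ (labelled by $A$), $T$ (labelled by $B$), $v\in A$ and a map $f:E(S,v)\to v(T)$, $S\circ_v^fT$ is obtained by replacing $v$ by $T$ and connecting each edge $a\in E(S,v)$ to the vertex $f(a)$ of $T$; if $v$ is not the root of $S$, the edge going down from $v$ now goes down from the root of $T$; weights are inherited. Then $S\circ_{v,\lambda}T=\sum_{f:E(S,v)\to v(T)}\lambda^{d(S\circ_v^fT)-d(S\circ_v^{f_0}T)}S\circ_v^fT$ if $|T|=|v|$ and $0$ otherwise, where $f_0$ sends every edge to the root of $T$. The operad $\mathcal{B}^\lambda$. $\mathcal{B}_{A,W}$ is spanned by planar rooted trees labelled by $A$ with weight function $W$, and $\mathcal{B}_A=\prod_W\mathcal{B}_{A,W}$. An angle of a planar tree $T$ is a pair of a vertex $s$ and a sector around $s$ cut out by $T$ in a small disk centred at $s$; a vertex with $k$ children has $k+1$ angles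 $(s,0),\dots,(s,k)$ from left to right (before the first child, between consecutive children, after the last). $Ang(T)$ is totally ordered: for $T=B_+(r,T_1\cdots T_k)$, $(r,0)<Ang(T_1)<(r,1)<\cdots<Ang(T_k)<(r,k)$, recursively. $Ang^0(T)$ is the set of angles at the root. "Increasing" means weakly increasing. For increasing $f:E(S,v)\to Ang(T)$, $S\diamond_v^fT$ is the planar weighted tree obtained by replacing $v$ by $T$, plugging each edge $a\in E(S,v)$ with its branch into the angle $f(a)$ (edges plugged into the same angle keep their left-to-right order), the edge going down from $v$, if any, now going down from the root of $T$ at the same position; weights are inherited. Then $S\diamond_{v,\lambda}T=\sum_{f}\lambda^{d(S\diamond_v^fT)-d(S\diamond_v^{f_0}T)}S\diamond_v^fT$ (sum over increasing $f:E(S,v)\to Ang(T)$) if $|T|=|v|$ and $0$ otherwise, where $f_0:E(S,v)\to Ang^0(T)$ is any increasing map (the energy $d(S\diamond_v^{f_0}T)$ does not depend on its choice). In both operads the unit is $e=\sum_{n\ge1}\bullet_n$, with $\bullet_n$ the one-vertex tree of weight $n$, and compositions are extended to the direct products componentwise (each component of a composite involves only one pair $(W,X)$). The map $\varphi$. $\varphi$ sends a labelled (weighted) non-planar rooted tree to the sum of all its planar representations, keeping labels and weights: $\varphi(\bullet)=\bullet$ on one-vertex trees and $\varphi(B_+(r,T_1\cdots T_k))=B_+(r,\varphi(T_1)\sqcup\cdots\sqcup\varphi(T_k))$, where $\sqcup$ is the shuffle product of words whose letters are planar trees (so that $\varphi(T_1)\sqcup\cdots\sqcup\varphi(T_k)=\sum_{\sigma\in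 S_k}\varphi(T_{\sigma(1)})\cdots\varphi(T_{\sigma(k)})$, expanded multilinearly). It is extended linearly to $\mathcal{O}_{A,W}\to\mathcal{B}_{A,W}$ and componentwise to $\mathcal{O}_A\to\mathcal{B}_A$. *)

theory Defs
  imports "HOL-Library.Multiset" "HOL-Library.Poly_Mapping" "HOL-Library.FuncSet"
begin

section \<open>Free vector spaces\<close>

text \<open>The vector space spanned by a set of objects is rendered by finitely supported functions;
  the basis vector of \<open>t\<close> is \<open>Poly_Mapping.single t 1\<close>.\<close>

definition scale :: "'k::comm_ring_1 \<Rightarrow> ('t \<Rightarrow>\<^sub>0 'k) \<Rightarrow> ('t \<Rightarrow>\<^sub>0 'k)" where
  "scale c p = Poly_Mapping.map ((*) c) p"

definition lin_ext :: "('t \<Rightarrow> ('s \<Rightarrow>\<^sub>0 'k)) \<Rightarrow> ('t \<Rightarrow>\<^sub>0 'k) \<Rightarrow> ('s \<Rightarrow>\<^sub>0 'k::comm_ring_1)" where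
  "lin_ext g p = (\<Sum>t\<in>Poly_Mapping.keys p. scale (Poly_Mapping.lookup p t) (g t))"

definition bilin_ext ::
  "('s \<Rightarrow> 't \<Rightarrow> ('u \<Rightarrow>\<^sub>0 'k)) \<Rightarrow> ('s \<Rightarrow>\<^sub>0 'k) \<Rightarrow> ('t \<Rightarrow>\<^sub>0 'k) \<Rightarrow> ('u \<Rightarrow>\<^sub>0 'k::comm_ring_1)" where
  "bilin_ext g p q = lin_ext (\<lambda>s. lin_ext (g s) q) p"


section \<open>Data of a current-preserving operad, and morphisms\<close>

text \<open>Label sets are finite nonempty subsets of an arbitrary type; the coproduct of \<open>A - {v}\<close> and
  \<open>B\<close> is their union, so that partial compositions are considered when these two sets are disjoint
  (\<open>v \<in> B\<close> is allowed).\<close>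

definition weightings :: "'a set \<Rightarrow> ('a \<Rightarrow> nat) set" where
  "weightings A = A \<rightarrow>\<^sub>E {1..}"

text \<open>\<open>component P A W\<close> is the space of weight component \<open>W\<close>; an element of the full space of \<open>A\<close> is
  a family indexed by weight functions. For a bijection \<open>s\<close> from \<open>A'\<close> onto \<open>A\<close>, \<open>relabel P A' s\<close> is
  the right action \<open>x \<mapsto> x.s\<close> from the space of \<open>A\<close> to that of \<open>A'\<close>. \<open>pcomp P A v B\<close> is the partial
  composition at \<open>v \<in> A\<close>, and \<open>op_unit P a\<close> is the unit, as an element of the space of \<open>{a}\<close>.\<close>

record ('a, 'p, 'k) cp_operad_data =
  component :: "'a set \<Rightarrow> ('a \<Rightarrow> nat) \<Rightarrow> 'p set"
  smult :: "'k \<Rightarrow> 'p \<Rightarrow> 'p"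
  relabel :: "'a set \<Rightarrow> ('a \<Rightarrow> 'a) \<Rightarrow> (('a \<Rightarrow> nat) \<Rightarrow> 'p) \<Rightarrow> (('a \<Rightarrow> nat) \<Rightarrow> 'p)"
  pcomp :: "'a set \<Rightarrow> 'a \<Rightarrow> 'a set \<Rightarrow>
    (('a \<Rightarrow> nat) \<Rightarrow> 'p) \<Rightarrow> (('a \<Rightarrow> nat) \<Rightarrow> 'p) \<Rightarrow> (('a \<Rightarrow> nat) \<Rightarrow> 'p)"
  op_unit :: "'a \<Rightarrow> (('a \<Rightarrow> nat) \<Rightarrow> 'p)"

definition op_space ::
  "('a, 'p::ab_group_add, 'k) cp_operad_data \<Rightarrow> 'a set \<Rightarrow> (('a \<Rightarrow> nat) \<Rightarrow> 'p) set" where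
  "op_space P A = {x. (\<forall>W\<in>weightings A. x W \<in> component P A W) \<and> (\<forall>W. W \<notin> weightings A \<longrightarrow> x W = 0)}"

text \<open>The fourth condition says that \<open>\<phi> A\<close> is the product of its restrictions to the weight
  components. (This is stronger than mapping each component into the corresponding one, since a linear
  map on an infinite product is not determined by its values on the factors.)\<close>

definition cp_operad_morphism ::
  "('a, 'p::ab_group_add, 'k) cp_operad_data \<Rightarrow> ('a, 'q::ab_group_add, 'k) cp_operad_data \<Rightarrow>
   ('a set \<Rightarrow> (('a \<Rightarrow> nat) \<Rightarrow> 'p) \<Rightarrow> (('a \<Rightarrow> nat) \<Rightarrow> 'q)) \<Rightarrow> bool" where
  "cp_operad_morphism P Q \<phi> \<longleftrightarrow>
    (\<forall>A. finite A \<and> A \<noteq> {} \<longrightarrow>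
      \<phi> A \<in> op_space P A \<rightarrow> op_space Q A \<and>
      (\<forall>x\<in>op_space P A. \<forall>y\<in>op_space P A. \<phi> A (\<lambda>W. x W + y W) = (\<lambda>W. \<phi> A x W + \<phi> A y W)) \<and>
      (\<forall>c. \<forall>x\<in>op_space P A. \<phi> A (\<lambda>W. smult P c (x W)) = (\<lambda>W. smult Q c (\<phi> A x W))) \<and>
      (\<forall>x\<in>op_space P A. \<forall>y\<in>op_space P A. \<forall>W\<in>weightings A. x W = y W \<longrightarrow> \<phi> A x W = \<phi> A y W)) \<and>
    (\<forall>A A' s. finite A \<and> A \<noteq> {} \<and> bij_betw s A' A \<longrightarrow>
      (\<forall>x\<in>op_space P A. \<phi> A' (relabel P A' s x) = relabel Q A' s (\<phi> A x))) \<and>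
    (\<forall>A B v. finite A \<and> finite B \<and> B \<noteq> {} \<and> v \<in> A \<and> (A - {v}) \<inter> B = {} \<longrightarrow>
      (\<forall>x\<in>op_space P A. \<forall>y\<in>op_space P B.
        \<phi> ((A - {v}) \<union> B) (pcomp P A v B x y) = pcomp Q A v B (\<phi> A x) (\<phi> B y))) \<and>
    (\<forall>a. \<phi> {a} (op_unit P a) = op_unit Q a)"

definition weight_join :: "'a set \<Rightarrow> ('a \<Rightarrow> nat) \<Rightarrow> ('a \<Rightarrow> nat) \<Rightarrow> ('a \<Rightarrow> nat)" where
  "weight_join B W X = (\<lambda>a. if a \<in> B then X a else W a)"

text \<open>The operad data spanned by a kind of labelled trees: \<open>trees A\<close> are the trees labelled by \<open>A\<close>,
  \<open>mp\<close> renames labels, \<open>dot a\<close> is the one-vertex tree, and \<open>cmp W X v S T\<close> is the partial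
  composition of \<open>S\<close> (with weights \<open>W\<close>) and \<open>T\<close> (with weights \<open>X\<close>).
  As \<open>cmp W X v S T\<close> vanishes unless \<open>W v\<close> is the total weight of \<open>T\<close>, the only pair \<open>(W, X)\<close>
  contributing to the component \<open>Z\<close> of a composite is the one used in \<open>pcomp\<close>.\<close>

definition tree_operad ::
  "('a set \<Rightarrow> 't set) \<Rightarrow> (('a \<Rightarrow> 'a) \<Rightarrow> 't \<Rightarrow> 't) \<Rightarrow> ('a \<Rightarrow> 't) \<Rightarrow>
   (('a \<Rightarrow> nat) \<Rightarrow> ('a \<Rightarrow> nat) \<Rightarrow> 'a \<Rightarrow> 't \<Rightarrow> 't \<Rightarrow> ('t \<Rightarrow>\<^sub>0 'k)) \<Rightarrow>
   ('a, 't \<Rightarrow>\<^sub>0 'k::comm_ring_1, 'k) cp_operad_data" where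
  "tree_operad trees mp dot cmp =
    \<lparr> component = (\<lambda>A W. {p. Poly_Mapping.keys p \<subseteq> trees A}),
      smult = scale,
      relabel = (\<lambda>A' s x W'.
        if W' \<in> weightings A'
        then lin_ext (\<lambda>T. Poly_Mapping.single (mp (inv_into A' s) T) 1)
               (x (restrict (W' \<circ> inv_into A' s) (s ` A')))
        else 0),
      pcomp = (\<lambda>A v B x y Z.
        if Z \<in> weightings ((A - {v}) \<union> B)
        then let W = restrict (Z(v := (\<Sum>b\<in>B. Z b))) A; X = restrict Z B
             in bilin_ext (cmp W X v) (x W) (y X)
        else 0),
      op_unit = (\<lambda>a W. if W \<in> weightings {a} then Poly_Mapping.single (dot a) 1 else 0) \<rparr>"


section \<open>Non-planar rooted trees\<close>

datatype 'a rtree = RNode (rroot: 'a) "'a rtree multiset"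

primrec rlabels :: "'a rtree \<Rightarrow> 'a multiset" where
  "rlabels (RNode a M) = add_mset a (\<Sum>\<^sub># (image_mset rlabels M))"

definition rtrees :: "'a set \<Rightarrow> 'a rtree set" where
  "rtrees A = {T. rlabels T = mset_set A}"

text \<open>The vertices together with their heights:\<close>

primrec rheights :: "'a rtree \<Rightarrow> ('a \<times> nat) multiset" where
  "rheights (RNode a M) = add_mset (a, 0) (image_mset (map_prod id Suc) (\<Sum>\<^sub># (image_mset rheights M)))"

definition renergy :: "('a \<Rightarrow> nat) \<Rightarrow> 'a rtree \<Rightarrow> nat" where
  "renergy W T = (\<Sum>(a, h)\<in>#rheights T. W a * h)"

definition rweight :: "('a \<Rightarrow> nat) \<Rightarrow> 'a rtree \<Rightarrow> nat" where
  "rweight W T = (\<Sum>a\<in>#rlabels T. W a)"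

text \<open>The edges joining \<open>v\<close> to its children are identified with the (labels of the) children.\<close>

primrec redges :: "'a \<Rightarrow> 'a rtree \<Rightarrow> 'a multiset" where
  "redges v (RNode a M) =
    (if a = v then image_mset rroot M else \<Sum>\<^sub># (image_mset (redges v) M))"

text \<open>\<open>rgraft g T\<close> attaches the branches \<open>g b\<close> to each vertex \<open>b\<close> of \<open>T\<close>, and \<open>rsubst v f S T\<close> is
  the tree obtained from \<open>S\<close> by replacing \<open>v\<close> by \<open>T\<close> according to \<open>f\<close>.\<close>

primrec rgraft :: "('a \<Rightarrow> 'a rtree multiset) \<Rightarrow> 'a rtree \<Rightarrow> 'a rtree" where
  "rgraft g (RNode b M) = RNode b (g b + image_mset (rgraft g) M)"

primrec rsubst :: "'a \<Rightarrow> ('a \<Rightarrow> 'a) \<Rightarrow> 'a rtree \<Rightarrow> 'a rtree \<Rightarrow> 'a rtree" where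
  "rsubst v f (RNode a M) T =
    (if a = v then rgraft (\<lambda>b. {# U \<in># M. f (rroot U) = b #}) T
     else RNode a (image_mset (\<lambda>S. rsubst v f S T) M))"

text \<open>The subtraction of energies is not truncated: attaching all edges to the root of \<open>T\<close> minimises
  the energy.\<close>

definition rcomp ::
  "'k::comm_ring_1 \<Rightarrow> ('a \<Rightarrow> nat) \<Rightarrow> ('a \<Rightarrow> nat) \<Rightarrow> 'a \<Rightarrow> 'a rtree \<Rightarrow> 'a rtree \<Rightarrow> ('a rtree \<Rightarrow>\<^sub>0 'k)" where
  "rcomp lam W X v S T =
    (if rweight X T = W v
     then \<Sum>f \<in> set_mset (redges v S) \<rightarrow>\<^sub>E set_mset (rlabels T).
       Poly_Mapping.single (rsubst v f S T)
         (let d = renergy (weight_join (set_mset (rlabels T)) W X)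
          in lam ^ (d (rsubst v f S T) - d (rsubst v (\<lambda>_. rroot T) S T)))
     else 0)"

definition O_operad :: "'k::comm_ring_1 \<Rightarrow> ('a, 'a rtree \<Rightarrow>\<^sub>0 'k, 'k) cp_operad_data" where
  "O_operad lam = tree_operad rtrees map_rtree (\<lambda>a. RNode a {#}) (rcomp lam)"


section \<open>Planar rooted trees\<close>

datatype 'a ptree = PNode (proot: 'a) "'a ptree list"

primrec plabels :: "'a ptree \<Rightarrow> 'a list" where
  "plabels (PNode a Ts) = a # concat (map plabels Ts)"

definition ptrees :: "'a set \<Rightarrow> 'a ptree set" where
  "ptrees A = {T. distinct (plabels T) \<and> set (plabels T) = A}"

primrec pheights :: "'a ptree \<Rightarrow> ('a \<times> nat) list" where
  "pheights (PNode a Ts) = (a, 0) # map (map_prod id Suc) (concat (map pheights Ts))"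

definition penergy :: "('a \<Rightarrow> nat) \<Rightarrow> 'a ptree \<Rightarrow> nat" where
  "penergy W T = (\<Sum>(a, h)\<leftarrow>pheights T. W a * h)"

definition pweight :: "('a \<Rightarrow> nat) \<Rightarrow> 'a ptree \<Rightarrow> nat" where
  "pweight W T = (\<Sum>a\<leftarrow>plabels T. W a)"

text \<open>The edges from \<open>v\<close> to its children, from left to right:\<close>

primrec pedges :: "'a \<Rightarrow> 'a ptree \<Rightarrow> 'a list" where
  "pedges v (PNode a Ts) = (if a = v then map proot Ts else concat (map (pedges v) Ts))"

text \<open>The angles, in increasing order:\<close>

primrec angles :: "'a ptree \<Rightarrow> ('a \<times> nat) list" where
  "angles (PNode a Ts) =
    (a, 0) # concat (map2 (\<lambda>i as. as @ [(a, Suc i)]) [0..<length Ts] (map angles Ts))"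

definition angle_le :: "'a ptree \<Rightarrow> 'a \<times> nat \<Rightarrow> 'a \<times> nat \<Rightarrow> bool" where
  "angle_le T \<alpha> \<beta> \<longleftrightarrow> (\<exists>i j. i \<le> j \<and> j < length (angles T) \<and> angles T ! i = \<alpha> \<and> angles T ! j = \<beta>)"

definition increasing_maps :: "'a \<Rightarrow> 'a ptree \<Rightarrow> 'a ptree \<Rightarrow> ('a \<Rightarrow> 'a \<times> nat) set" where
  "increasing_maps v S T =
    {f \<in> set (pedges v S) \<rightarrow>\<^sub>E set (angles T). sorted_wrt (angle_le T) (map f (pedges v S))}"

text \<open>\<open>pgraft g T\<close> plugs the forest \<open>g \<alpha>\<close> into each angle \<open>\<alpha>\<close> of \<open>T\<close>.\<close>

primrec pgraft :: "('a \<times> nat \<Rightarrow> 'a ptree list) \<Rightarrow> 'a ptree \<Rightarrow> 'a ptree" where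
  "pgraft g (PNode b Ts) =
    PNode b (g (b, 0) @
      concat (map2 (\<lambda>i U. U # g (b, Suc i)) [0..<length Ts] (map (pgraft g) Ts)))"

primrec psubst :: "'a \<Rightarrow> ('a \<Rightarrow> 'a \<times> nat) \<Rightarrow> 'a ptree \<Rightarrow> 'a ptree \<Rightarrow> 'a ptree" where
  "psubst v f (PNode a Ss) T =
    (if a = v then pgraft (\<lambda>\<alpha>. filter (\<lambda>U. f (proot U) = \<alpha>) Ss) T
     else PNode a (map (\<lambda>S. psubst v f S T) Ss))"

text \<open>The reference map plugs every edge into the leftmost angle at the root of \<open>T\<close>.\<close>

definition pcomp_tree ::
  "'k::comm_ring_1 \<Rightarrow> ('a \<Rightarrow> nat) \<Rightarrow> ('a \<Rightarrow> nat) \<Rightarrow> 'a \<Rightarrow> 'a ptree \<Rightarrow> 'a ptree \<Rightarrow> ('a ptree \<Rightarrow>\<^sub>0 'k)" where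
  "pcomp_tree lam W X v S T =
    (if pweight X T = W v
     then \<Sum>f \<in> increasing_maps v S T.
       Poly_Mapping.single (psubst v f S T)
         (let d = penergy (weight_join (set (plabels T)) W X)
          in lam ^ (d (psubst v f S T) - d (psubst v (\<lambda>_. (proot T, 0)) S T)))
     else 0)"

definition B_operad :: "'k::comm_ring_1 \<Rightarrow> ('a, 'a ptree \<Rightarrow>\<^sub>0 'k, 'k) cp_operad_data" where
  "B_operad lam = tree_operad ptrees map_ptree (\<lambda>a. PNode a []) (pcomp_tree lam)"


section \<open>Shuffle product and symmetrization\<close>

definition prefix_word :: "'l \<Rightarrow> ('l list \<Rightarrow>\<^sub>0 'k) \<Rightarrow> ('l list \<Rightarrow>\<^sub>0 'k::comm_ring_1)" where
  "prefix_word a = lin_ext (\<lambda>w. Poly_Mapping.single (a # w) 1)"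

fun shuffle_words :: "'l list \<Rightarrow> 'l list \<Rightarrow> ('l list \<Rightarrow>\<^sub>0 'k::comm_ring_1)" where
  "shuffle_words [] w = Poly_Mapping.single w 1"
| "shuffle_words u [] = Poly_Mapping.single u 1"
| "shuffle_words (a # u) (b # w) =
     prefix_word a (shuffle_words u (b # w)) + prefix_word b (shuffle_words (a # u) w)"

definition shuffle_prod ::
  "('l list \<Rightarrow>\<^sub>0 'k) \<Rightarrow> ('l list \<Rightarrow>\<^sub>0 'k) \<Rightarrow> ('l list \<Rightarrow>\<^sub>0 'k::comm_ring_1)" where
  "shuffle_prod = bilin_ext shuffle_words"

definition letter :: "('l \<Rightarrow>\<^sub>0 'k) \<Rightarrow> ('l list \<Rightarrow>\<^sub>0 'k::comm_ring_1)" where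
  "letter = lin_ext (\<lambda>l. Poly_Mapping.single [l] 1)"

definition B_plus :: "'a \<Rightarrow> ('a ptree list \<Rightarrow>\<^sub>0 'k) \<Rightarrow> ('a ptree \<Rightarrow>\<^sub>0 'k::comm_ring_1)" where
  "B_plus r = lin_ext (\<lambda>Ts. Poly_Mapping.single (PNode r Ts) 1)"

text \<open>\<open>sym_tree\<close> sends \<open>B_+(r, T_1 ... T_k)\<close> to \<open>B_+\<close> of the shuffle product of the images of
  \<open>T_1, ..., T_k\<close>, seen as combinations of one-letter words. The product over the multiset of branches
  makes sense because \<open>shuffle_prod\<close> is associative and commutative.\<close>

primrec sym_tree :: "'a rtree \<Rightarrow> ('a ptree \<Rightarrow>\<^sub>0 'k::comm_ring_1)" where
  "sym_tree (RNode r M) =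
    B_plus r (fold_mset shuffle_prod (Poly_Mapping.single [] 1) (image_mset (\<lambda>T. letter (sym_tree T)) M))"

definition symmetrization ::
  "'a set \<Rightarrow> (('a \<Rightarrow> nat) \<Rightarrow> ('a rtree \<Rightarrow>\<^sub>0 'k)) \<Rightarrow> (('a \<Rightarrow> nat) \<Rightarrow> ('a ptree \<Rightarrow>\<^sub>0 'k::comm_ring_1))" where
  "symmetrization A x = (\<lambda>W. lin_ext sym_tree (x W))"

end

theory Submission
  imports Defs
begin

text \<open>As labels are distinct, the symmetrization of \<open>S\<close> is the sum, with coefficients 1, of the planar
  trees from which \<open>S\<close> is obtained by forgetting the planar structure. The potential energy only
  depends on the underlying non-planar tree, so the theorem reduces to a bijection: triples
  \<open>(P, R, g)\<close>, with \<open>P\<close> and \<open>R\<close> planar representations of \<open>S\<close> and \<open>T\<close> and \<open>g\<close> an increasing map from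
  the edges at \<open>v\<close> to the angles of \<open>R\<close>, correspond to pairs \<open>(f, Q)\<close> with \<open>Q\<close> a planar representation
  of the tree obtained from \<open>S\<close>, \<open>T\<close> and \<open>f\<close>; here \<open>f\<close> sends an edge to the vertex carrying the angle
  \<open>g\<close> assigns to it. To recover \<open>(P, R, g)\<close> from \<open>Q\<close>, take the subtree at the root of \<open>T\<close> and cut off the
  branches whose roots are children of \<open>v\<close>: what remains is \<open>R\<close>, the branches read in the order of the
  angles are the branches of \<open>P\<close> at \<open>v\<close>, and the angles at which they were cut give \<open>g\<close>.\<close>

section \<open>Linear extensions\<close>

text \<open>The inverse is steered by labels that \<open>S\<close> and \<open>T\<close> fix in
  advance, never by the unknown planar representations. Two points shape it. An angle is a vertex
  with an index counted in \<open>R\<close>, whereas grafting shifts the positions of children; the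
  scan that cuts branches off therefore counts only the children that stay in \<open>R\<close>. And
  grafting splits the branches at \<open>v\<close> among the angles: their common order survives
  precisely because \<open>g\<close> is increasing, since reading the angles from left to right then
  restores it. For the same reason surjectivity is the harder half: \<open>f\<close> does not say
  how branches going to different vertices were interleaved at \<open>v\<close>, so \<open>P\<close>
  can be built only after its list of branches has been read off \<open>Q\<close>. Finally,
  \<open>sym_tree\<close> folds the shuffle product over a multiset, so a commutation law is
  required before a single branch can be split off.\<close>

lemma lookup_scale [simp]:
  "Poly_Mapping.lookup (scale c p) t = c * Poly_Mapping.lookup p t"
  by (simp add: scale_def Poly_Mapping.map.rep_eq when_def)

lemma scale_add_right: "scale c (p + q) = scale c p + scale c q"
  by (rule poly_mapping_eqI) (simp add: lookup_add algebra_simps)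

lemma scale_add_left: "scale (c + d) p = scale c p + scale d p"
  by (rule poly_mapping_eqI) (simp add: lookup_add algebra_simps)

lemma scale_zero_right [simp]: "scale c 0 = 0"
  by (rule poly_mapping_eqI) simp

lemma scale_zero_left [simp]: "scale 0 p = 0"
  by (rule poly_mapping_eqI) simp

lemma scale_one [simp]: "scale 1 p = p"
  by (rule poly_mapping_eqI) simp

lemma scale_scale: "scale c (scale d p) = scale (c * d) p"
  by (rule poly_mapping_eqI) (simp add: algebra_simps)

lemma scale_single [simp]: "scale c (Poly_Mapping.single t d) = Poly_Mapping.single t (c * d)"
  by (rule poly_mapping_eqI) (simp add: lookup_single when_def)

lemma scale_sum: "scale c (sum f I) = (\<Sum>i\<in>I. scale c (f i))"
  by (induction I rule: infinite_finite_induct) (auto simp: scale_add_right)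

text \<open>Zero coefficients contribute nothing; enlarging the support gives two vectors a common
  index set.\<close>

lemma lin_ext_superset:
  assumes "finite K" "Poly_Mapping.keys p \<subseteq> K"
  shows "lin_ext g p = (\<Sum>t\<in>K. scale (Poly_Mapping.lookup p t) (g t))"
  unfolding lin_ext_def using assms
  by (intro sum.mono_neutral_left) (auto simp: in_keys_iff)

lemma lin_ext_zero [simp]: "lin_ext g 0 = 0"
  by (simp add: lin_ext_def)

lemma lin_ext_add: "lin_ext g (p + q) = lin_ext g p + lin_ext g q"
proof -
  let ?K = "Poly_Mapping.keys p \<union> Poly_Mapping.keys q"
  have "Poly_Mapping.keys (p + q) \<subseteq> ?K" by (rule Poly_Mapping.keys_add)
  then show ?thesis
    by (simp add: lin_ext_superset[of ?K] lookup_add scale_add_left sum.distrib)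
qed

lemma lin_ext_scale: "lin_ext g (scale c p) = scale c (lin_ext g p)"
proof -
  have "Poly_Mapping.keys (scale c p) \<subseteq> Poly_Mapping.keys p"
    by (auto simp: in_keys_iff)
  then show ?thesis
    by (simp add: lin_ext_superset[of "Poly_Mapping.keys p"] scale_sum scale_scale)
qed

lemma lin_ext_single [simp]: "lin_ext g (Poly_Mapping.single t c) = scale c (g t)"
  by (simp add: lin_ext_superset[of "{t}"])

lemma lin_ext_sum: "lin_ext g (sum f I) = (\<Sum>i\<in>I. lin_ext g (f i))"
  by (induction I rule: infinite_finite_induct) (auto simp: lin_ext_add)

lemma lin_ext_cong:
  assumes "\<And>t. t \<in> Poly_Mapping.keys p \<Longrightarrow> g t = h t"
  shows "lin_ext g p = lin_ext h p"
  using assms by (simp add: lin_ext_def)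

lemma lin_ext_fun_add: "lin_ext (\<lambda>t. g t + h t) p = lin_ext g p + lin_ext h p"
  by (simp add: lin_ext_def scale_add_right sum.distrib)

lemma lin_ext_lin_ext: "lin_ext g (lin_ext f p) = lin_ext (\<lambda>t. lin_ext g (f t)) p"
  by (subst (2 3) lin_ext_def) (simp add: lin_ext_sum lin_ext_scale)

lemma lin_ext_swap:
  "lin_ext (\<lambda>s. lin_ext (\<lambda>t. F s t) q) p = lin_ext (\<lambda>t. lin_ext (\<lambda>s. F s t) p) q"
  unfolding lin_ext_def scale_sum
  by (subst sum.swap) (simp add: scale_scale mult.commute)

lemma lin_ext_id: "lin_ext (\<lambda>t. Poly_Mapping.single t 1) p = p"
proof (rule poly_mapping_eqI)
  fix k
  show "Poly_Mapping.lookup (lin_ext (\<lambda>t. Poly_Mapping.single t 1) p) k = Poly_Mapping.lookup p k"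
    by (auto simp: lin_ext_def lookup_sum lookup_single when_def in_keys_iff)
qed

lemma keys_lin_ext:
  assumes "\<And>t. t \<in> Poly_Mapping.keys p \<Longrightarrow> Poly_Mapping.keys (g t) \<subseteq> A"
  shows "Poly_Mapping.keys (lin_ext g p) \<subseteq> A"
proof
  fix k assume "k \<in> Poly_Mapping.keys (lin_ext g p)"
  then have "(\<Sum>t\<in>Poly_Mapping.keys p. Poly_Mapping.lookup p t * Poly_Mapping.lookup (g t) k) \<noteq> 0"
    by (simp add: in_keys_iff lin_ext_def lookup_sum)
  then obtain t where "t \<in> Poly_Mapping.keys p" "Poly_Mapping.lookup (g t) k \<noteq> 0"
    by (metis (no_types, lifting) mult_zero_right sum.neutral)
  then show "k \<in> A"
    using assms by (force simp: in_keys_iff)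
qed


section \<open>The shuffle product\<close>

lemma shuffle_words_Nil2 [simp]: "shuffle_words u [] = Poly_Mapping.single u 1"
  by (cases u) simp_all

lemma shuffle_words_commute: "shuffle_words u v = shuffle_words v u"
  by (induction u v rule: shuffle_words.induct) (simp_all add: add.commute)

lemma lin_ext_shuffle_Nil:
  fixes p :: "'l list \<Rightarrow>\<^sub>0 'k::comm_ring_1"
  shows "lin_ext (shuffle_words []) p = p"
proof -
  have "shuffle_words [] = (\<lambda>w :: 'l list. Poly_Mapping.single w (1 :: 'k))"
    by (simp add: fun_eq_iff)
  then show ?thesis by (simp add: lin_ext_id)
qed

lemma prefix_word_add: "prefix_word a (p + q) = prefix_word a p + prefix_word a q"
  by (simp add: prefix_word_def lin_ext_add)

text \<open>The defining recursion requires both words to be nonempty; combinations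
  \<open>prefix_word b p\<close> involve only such words, so it extends to them linearly.\<close>

lemma lin_ext_shuffle_prefix:
  "lin_ext (shuffle_words (a # u)) (prefix_word b p) =
     prefix_word a (lin_ext (shuffle_words u) (prefix_word b p)) +
     prefix_word b (lin_ext (shuffle_words (a # u)) p)"
  by (simp add: prefix_word_def lin_ext_lin_ext flip: lin_ext_fun_add)

text \<open>Left commutativity is the law that a fold over a multiset requires. Expanded by the
  first letter, both sides become three sums of the same shape, one for each of \<open>u\<close>,
  \<open>v\<close>, \<open>w\<close> supplying that letter, and every remaining triple is
  shorter.\<close>

lemma shuffle_words_left_commute:
  fixes u v w :: "'l list"
  shows "(lin_ext (shuffle_words u) (shuffle_words v w) :: 'l list \<Rightarrow>\<^sub>0 'k::comm_ring_1) =
    lin_ext (shuffle_words v) (shuffle_words u w)"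
proof (induction "length u + length v + length w" arbitrary: u v w rule: less_induct)
  case less
  show ?case
  proof (cases "u = [] \<or> v = [] \<or> w = []")
    case True
    then show ?thesis
    proof (elim disjE)
      assume "w = []"
      then show ?thesis by (simp add: shuffle_words_commute[of u v])
    next
      assume "u = []"
      then show ?thesis by (simp add: lin_ext_shuffle_Nil)
    next
      assume "v = []"
      then show ?thesis by (simp add: lin_ext_shuffle_Nil)
    qed
  next
    case False
    then obtain a u' b v' c w' where uvw: "u = a # u'" "v = b # v'" "w = c # w'"
      by (auto simp: neq_Nil_conv)
    have "(lin_ext (shuffle_words u) (shuffle_words v w) :: 'l list \<Rightarrow>\<^sub>0 'k) =
      prefix_word a (lin_ext (shuffle_words u') (shuffle_words v w)) +
      prefix_word b (lin_ext (shuffle_words u) (shuffle_words v' w)) +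
      prefix_word c (lin_ext (shuffle_words u) (shuffle_words v w'))"
      by (simp add: uvw lin_ext_add lin_ext_shuffle_prefix prefix_word_add add_ac)
    moreover have "(lin_ext (shuffle_words v) (shuffle_words u w) :: 'l list \<Rightarrow>\<^sub>0 'k) =
      prefix_word b (lin_ext (shuffle_words v') (shuffle_words u w)) +
      prefix_word a (lin_ext (shuffle_words v) (shuffle_words u' w)) +
      prefix_word c (lin_ext (shuffle_words v) (shuffle_words u w'))"
      by (simp add: uvw lin_ext_add lin_ext_shuffle_prefix prefix_word_add add_ac)
    moreover have "(lin_ext (shuffle_words u') (shuffle_words v w) :: 'l list \<Rightarrow>\<^sub>0 'k) =
        lin_ext (shuffle_words v) (shuffle_words u' w)"
      "(lin_ext (shuffle_words u) (shuffle_words v' w) :: 'l list \<Rightarrow>\<^sub>0 'k) =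
        lin_ext (shuffle_words v') (shuffle_words u w)"
      "(lin_ext (shuffle_words u) (shuffle_words v w') :: 'l list \<Rightarrow>\<^sub>0 'k) =
        lin_ext (shuffle_words v) (shuffle_words u w')"
      by (rule less.hyps, simp add: uvw)+
    ultimately show ?thesis by (simp add: add_ac)
  qed
qed

lemma comp_fun_commute_shuffle_prod: "comp_fun_commute shuffle_prod"
proof
  fix x y :: "'a list \<Rightarrow>\<^sub>0 'b"
  show "shuffle_prod y \<circ> shuffle_prod x = shuffle_prod x \<circ> shuffle_prod y"
  proof
    fix z
    have nf: "shuffle_prod x (shuffle_prod y z) =
        lin_ext (\<lambda>u. lin_ext (\<lambda>v. lin_ext (\<lambda>w. lin_ext (shuffle_words u) (shuffle_words v w)) z) y) x"
      for x y z :: "'a list \<Rightarrow>\<^sub>0 'b"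
      by (simp add: shuffle_prod_def bilin_ext_def lin_ext_lin_ext)
    show "(shuffle_prod y \<circ> shuffle_prod x) z = (shuffle_prod x \<circ> shuffle_prod y) z"
      by (simp add: nf lin_ext_swap[of _ x y] shuffle_words_left_commute)
  qed
qed

lemma shuffle_words_letter:
  "(shuffle_words [l] w :: 'l list \<Rightarrow>\<^sub>0 'k::comm_ring_1) =
    (\<Sum>i\<le>length w. Poly_Mapping.single (take i w @ l # drop i w) 1)"
proof (induction w)
  case (Cons a w)
  have "(shuffle_words [l] (a # w) :: 'l list \<Rightarrow>\<^sub>0 'k) =
      Poly_Mapping.single (l # a # w) 1 + prefix_word a (shuffle_words [l] w)"
    by (simp add: prefix_word_def)
  also have "prefix_word a (shuffle_words [l] w :: 'l list \<Rightarrow>\<^sub>0 'k) =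
      (\<Sum>i\<le>length w. Poly_Mapping.single (a # take i w @ l # drop i w) 1)"
    by (simp add: Cons prefix_word_def lin_ext_sum)
  \<comment> \<open>Splitting off index 0 accounts for the letter placed in front of
    \<open>a\<close>; the positions in \<open>w\<close> move up by one.\<close>
  finally show ?case
    by (simp del: shuffle_words.simps sum.atMost_Suc add: sum.atMost_Suc_shift)
qed simp


section \<open>Planar representations\<close>

primrec forget :: "'a ptree \<Rightarrow> 'a rtree" where
  "forget (PNode a Ps) = RNode a (mset (map forget Ps))"

definition planar_reps :: "'a rtree \<Rightarrow> 'a ptree set" where
  "planar_reps S = {P. forget P = S}"

definition planar_forests :: "'a rtree multiset \<Rightarrow> 'a ptree list set" where
  "planar_forests M = {Ps. mset (map forget Ps) = M}"

text \<open>The multiset form of \<open>distinct\<close>, stated with \<open>mset_set\<close>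
  because \<open>rtrees\<close> prescribes the labels in that form.\<close>

definition nodup :: "'a multiset \<Rightarrow> bool" where
  "nodup M \<longleftrightarrow> M = mset_set (set_mset M)"

lemma nodup_iff_count: "nodup M \<longleftrightarrow> (\<forall>x. count M x \<le> 1)"
proof
  assume "nodup M"
  then have "count M x = count (mset_set (set_mset M)) x" for x
    by (simp add: nodup_def)
  then show "\<forall>x. count M x \<le> 1"
    by (metis count_mset_set(1,3) finite_set_mset le_refl zero_le_one)
next
  assume *: "\<forall>x. count M x \<le> 1"
  show "nodup M" unfolding nodup_def
  proof (rule multiset_eqI)
    fix x show "count M x = count (mset_set (set_mset M)) x"
    proof (cases "x \<in># M")
      case True
      then have "count M x \<ge> 1" by simp
      with * True show ?thesis by (simp add: le_antisym)
    next
      case False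
      then show ?thesis by (simp add: not_in_iff)
    qed
  qed
qed

lemma nodup_mono: "nodup N \<Longrightarrow> M \<subseteq># N \<Longrightarrow> nodup M"
  unfolding nodup_iff_count by (meson le_trans mset_subset_eq_count)

lemma nodup_mset [simp]: "nodup (mset xs) \<longleftrightarrow> distinct xs"
  unfolding nodup_def by (metis finite_set_mset mset_set_set set_mset_mset distinct_count_atmost_1 count_mset_set(1,3))

lemma nodup_add: "nodup (M + N) \<longleftrightarrow> nodup M \<and> nodup N \<and> set_mset M \<inter> set_mset N = {}"
proof -
  obtain xs ys where "M = mset xs" "N = mset ys" by (metis ex_mset)
  then show ?thesis by (simp flip: mset_append)
qed

lemma nodup_add_mset: "nodup (add_mset a M) \<longleftrightarrow> nodup M \<and> a \<notin># M"
  using nodup_add[of "{#a#}" M] by (auto simp: nodup_def)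

lemma proot_forget [simp]: "rroot (forget P) = proot P"
  by (cases P) simp

lemma rlabels_forget: "rlabels (forget P) = mset (plabels P)"
proof (induction P)
  case (PNode a Ps)
  have "{#rlabels (forget P). P \<in># mset Ps#} = {#mset (plabels P). P \<in># mset Ps#}"
    by (rule image_mset_cong) (simp add: PNode)
  then show ?case
    by (simp add: mset_concat image_mset.compositionality comp_def flip: sum_mset_sum_list)
qed

lemma rroot_in_rlabels [simp]: "rroot S \<in># rlabels S"
  by (cases S) simp

lemma proot_in_plabels [simp]: "proot P \<in> set (plabels P)"
  by (cases P) simp

lemma rtrees_iff: "S \<in> rtrees A \<Longrightarrow> finite A \<Longrightarrow> nodup (rlabels S) \<and> set_mset (rlabels S) = A"
  by (auto simp: rtrees_def nodup_def)

text \<open>The children form a list of fixed length over a finite set. Finiteness matters because a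
  sum over an infinite set is 0 by convention.\<close>

lemma finite_planar_reps: "finite (planar_reps S)"
proof (induction S)
  case (RNode a M)
  have "planar_reps (RNode a M) \<subseteq>
    PNode a ` {Ps. set Ps \<subseteq> (\<Union>U\<in>set_mset M. planar_reps U) \<and> length Ps = size M}"
  proof
    fix P assume "P \<in> planar_reps (RNode a M)"
    then obtain Ps where P: "P = PNode a Ps" "mset (map forget Ps) = M"
      by (cases P) (auto simp: planar_reps_def)
    then have "set Ps \<subseteq> (\<Union>U\<in>set_mset M. planar_reps U)" "length Ps = size M"
      by (auto simp: planar_reps_def)
    with P show "P \<in> PNode a ` {Ps. set Ps \<subseteq> (\<Union>U\<in>set_mset M. planar_reps U) \<and> length Ps = size M}"
      by blast
  qed
  moreover have "finite {Ps. set Ps \<subseteq> (\<Union>U\<in>set_mset M. planar_reps U) \<and> length Ps = size M}"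
    by (intro finite_lists_length_eq) (auto simp: RNode)
  ultimately show ?case
    by (meson finite_imageI finite_subset)
qed

lemma planar_reps_RNode: "planar_reps (RNode a M) = PNode a ` planar_forests M"
proof (intro set_eqI)
  fix P show "P \<in> planar_reps (RNode a M) \<longleftrightarrow> P \<in> PNode a ` planar_forests M"
    by (cases P) (auto simp: planar_reps_def planar_forests_def)
qed

lemma finite_planar_forests: "finite (planar_forests M)"
proof -
  have "finite (PNode undefined ` planar_forests M)"
    unfolding planar_reps_RNode[symmetric] by (rule finite_planar_reps)
  then show ?thesis by (rule finite_imageD) (simp add: inj_on_def)
qed

lemma mset_map_eq_add_msetE:
  assumes "mset (map f xs) = add_mset a M"
  obtains us x ws where "xs = us @ x # ws" "f x = a" "mset (map f (us @ ws)) = M"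
proof -
  have "a \<in> f ` set xs"
    using assms by (metis list.set_map set_mset_mset union_single_eq_member)
  then obtain x where x: "x \<in> set xs" "f x = a" by auto
  then obtain us ws where "xs = us @ x # ws" by (meson split_list)
  moreover from this x assms have "mset (map f (us @ ws)) = M" by simp
  ultimately show thesis using that x by blast
qed

lemma takeWhile_insertion:
  "(\<And>x. x \<in> set us \<Longrightarrow> Q x) \<Longrightarrow> \<not> Q x \<Longrightarrow> takeWhile Q (us @ x # ws) = us"
  by (induction us) auto

text \<open>This is the combinatorial content of shuffling with one letter. As \<open>U\<close> does
  not occur in \<open>M\<close>, the inserted tree is the only one with underlying tree
  \<open>U\<close>, so the insertion can be undone.\<close>

lemma bij_betw_insertion:
  assumes "U \<notin># M"
  shows "bij_betw (\<lambda>(P, Ps, i). take i Ps @ P # drop i Ps)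
    (SIGMA P:planar_reps U. SIGMA Ps:planar_forests M. {..length Ps}) (planar_forests (add_mset U M))"
    (is "bij_betw ?F ?D ?R")
proof (rule bij_betwI')
  fix x y assume x: "x \<in> ?D" and y: "y \<in> ?D"
  obtain P Ps i P' Ps' i' where xy: "x = (P, Ps, i)" "y = (P', Ps', i')"
    by (metis prod_cases3)
  \<comment> \<open>The part before the inserted tree is the longest prefix avoiding
    \<open>U\<close>; comparing lengths then gives the index.\<close>
  have key: "takeWhile (\<lambda>X. forget X \<noteq> U) (take i Ps @ P # drop i Ps) = take i Ps"
    if "(P, Ps, i) \<in> ?D" for P Ps i
  proof (rule takeWhile_insertion)
    fix X assume "X \<in> set (take i Ps)"
    then have "forget X \<in># mset (map forget Ps)"
      by (auto dest: in_set_takeD)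
    with that assms show "forget X \<noteq> U"
      by (auto simp: planar_forests_def simp del: mset_map)
  qed (use that in \<open>simp add: planar_reps_def\<close>)
  show "?F x = ?F y \<longleftrightarrow> x = y"
  proof
    assume eq: "?F x = ?F y"
    then have t: "take i Ps = take i' Ps'"
      using key[of P Ps i] key[of P' Ps' i'] x y by (simp add: xy)
    then have d: "P = P'" "drop i Ps = drop i' Ps'" using eq by (auto simp: xy)
    have "i = i'" using arg_cong[OF t, of length] x y by (auto simp: xy min_def split: if_splits)
    moreover have "Ps = Ps'" using t d by (metis append_take_drop_id)
    ultimately show "x = y" using d by (simp add: xy)
  qed simp
next
  fix x assume x: "x \<in> ?D"
  obtain P Ps i where xy: "x = (P, Ps, i)" by (metis prod_cases3)
  have "mset (take i Ps) + mset (drop i Ps) = mset Ps"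
    by (simp flip: mset_append)
  then have "mset (map forget (take i Ps @ P # drop i Ps)) = add_mset (forget P) (mset (map forget Ps))"
    by (simp flip: image_mset_union)
  then show "?F x \<in> ?R" using x by (simp add: xy planar_reps_def planar_forests_def)
next
  fix y assume "y \<in> ?R"
  then have "mset (map forget y) = add_mset U M"
    by (simp add: planar_forests_def)
  then obtain us P ws where y: "y = us @ P # ws" "forget P = U" "mset (map forget (us @ ws)) = M"
    by (rule mset_map_eq_add_msetE)
  then have "(P, us @ ws, length us) \<in> ?D" by (simp add: planar_reps_def planar_forests_def)
  moreover have "?F (P, us @ ws, length us) = y" using y by simp
  ultimately show "\<exists>x\<in>?D. y = ?F x"
    by (intro bexI[of _ "(P, us @ ws, length us)"]) simp_all
qed

text \<open>The map \<open>s\<close> stands for \<open>sym_tree\<close> on the branches; keeping it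
  abstract lets the induction on trees supply its values. Each further branch is a letter, and
  shuffling with it is an insertion.\<close>

lemma fold_shuffle_letters:
  assumes "nodup (\<Sum>\<^sub># (image_mset rlabels M))"
    and "\<And>U. U \<in># M \<Longrightarrow> s U = (\<Sum>P\<in>planar_reps U. Poly_Mapping.single P 1)"
  shows "fold_mset shuffle_prod (Poly_Mapping.single [] 1) (image_mset (\<lambda>T. letter (s T)) M) =
    (\<Sum>Ps\<in>planar_forests M. Poly_Mapping.single Ps (1 :: 'k::comm_ring_1))"
  using assms
proof (induction M)
  case empty
  have "planar_forests ({#} :: 'a rtree multiset) = {[]}" by (auto simp: planar_forests_def)
  then show ?case by simp
next
  case (add U M)
  interpret comp_fun_commute "shuffle_prod :: ('a ptree list \<Rightarrow>\<^sub>0 'k) \<Rightarrow> _"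
    by (rule comp_fun_commute_shuffle_prod)
  have nd: "nodup (rlabels U)" "nodup (\<Sum>\<^sub># (image_mset rlabels M))"
    "set_mset (rlabels U) \<inter> set_mset (\<Sum>\<^sub># (image_mset rlabels M)) = {}"
    using add.prems(1) by (auto simp: nodup_add)
  \<comment> \<open>A second copy of \<open>U\<close> would repeat the label of its root.\<close>
  have notin: "U \<notin># M"
    using nd(3) rroot_in_rlabels[of U] by fastforce
  have "fold_mset shuffle_prod (Poly_Mapping.single [] 1) (image_mset (\<lambda>T. letter (s T)) (add_mset U M)) =
      shuffle_prod (letter (\<Sum>P\<in>planar_reps U. Poly_Mapping.single P 1))
        (\<Sum>Ps\<in>planar_forests M. Poly_Mapping.single Ps (1 :: 'k))"
    using add nd by simp
  also have "\<dots> = (\<Sum>P\<in>planar_reps U. \<Sum>Ps\<in>planar_forests M. shuffle_words [P] Ps)"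
    by (simp add: shuffle_prod_def bilin_ext_def letter_def lin_ext_sum)
  also have "\<dots> = (\<Sum>(P, Ps, i)\<in>(SIGMA P:planar_reps U. SIGMA Ps:planar_forests M. {..length Ps}).
      Poly_Mapping.single (take i Ps @ P # drop i Ps) 1)"
    by (simp add: shuffle_words_letter sum.Sigma finite_planar_reps finite_planar_forests)
  also have "\<dots> = (\<Sum>Ps\<in>planar_forests (add_mset U M). Poly_Mapping.single Ps 1)"
    using sum.reindex_bij_betw[OF bij_betw_insertion[OF notin],
        of "\<lambda>Ps. Poly_Mapping.single Ps (1 :: 'k)"]
    by (simp add: case_prod_unfold)
  finally show ?case .
qed

lemma sym_tree_eq:
  assumes "nodup (rlabels S)"
  shows "sym_tree S = (\<Sum>P\<in>planar_reps S. Poly_Mapping.single P (1 :: 'k::comm_ring_1))"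
  using assms
proof (induction S)
  case (RNode a M)
  have "nodup (rlabels U)" if "U \<in># M" for U
    using RNode.prems that by (auto simp: nodup_add_mset nodup_add dest!: multi_member_split)
  moreover have "nodup (\<Sum>\<^sub># (image_mset rlabels M))"
    using RNode.prems by (auto simp: nodup_add_mset)
  ultimately have "sym_tree (RNode a M) =
      B_plus a (\<Sum>Ps\<in>planar_forests M. Poly_Mapping.single Ps (1 :: 'k))"
    using RNode.IH by (simp add: fold_shuffle_letters)
  also have "\<dots> = (\<Sum>P\<in>planar_reps (RNode a M). Poly_Mapping.single P 1)"
    by (simp add: B_plus_def lin_ext_sum planar_reps_RNode sum.reindex inj_on_def)
  finally show ?case .
qed

lemma keys_sym_tree:
  assumes "finite A" "S \<in> rtrees A"
  shows "Poly_Mapping.keys (sym_tree S :: 'a ptree \<Rightarrow>\<^sub>0 'k::comm_ring_1) \<subseteq> ptrees A"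
proof
  fix P assume P: "P \<in> Poly_Mapping.keys (sym_tree S :: 'a ptree \<Rightarrow>\<^sub>0 'k)"
  have S: "nodup (rlabels S)" "set_mset (rlabels S) = A"
    using rtrees_iff[OF assms(2,1)] by auto
  from P have "P \<in> planar_reps S"
    unfolding sym_tree_eq[OF S(1)]
    using keys_sum[of "\<lambda>P. Poly_Mapping.single P (1 :: 'k)" "planar_reps S"] by auto
  then have "mset (plabels P) = rlabels S"
    by (simp add: planar_reps_def flip: rlabels_forget)
  with S show "P \<in> ptrees A"
    by (metis (mono_tags, lifting) mem_Collect_eq nodup_mset ptrees_def set_mset_mset)
qed


section \<open>Branches and replacement of a vertex\<close>

primrec pbranches :: "'a \<Rightarrow> 'a ptree \<Rightarrow> 'a ptree list" where
  "pbranches v (PNode a Ps) = (if a = v then Ps else concat (map (pbranches v) Ps))"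

text \<open>Unlike \<open>psubst\<close>, this discards the branches at \<open>v\<close>. It
  separates the place where \<open>v\<close> sits from what is grafted there.\<close>

primrec preplace :: "'a \<Rightarrow> 'a ptree \<Rightarrow> 'a ptree \<Rightarrow> 'a ptree" where
  "preplace v Y (PNode a Ps) = (if a = v then Y else PNode a (map (preplace v Y) Ps))"

lemma pedges_eq: "pedges v P = map proot (pbranches v P)"
  by (induction P) (auto simp: map_concat intro!: arg_cong[where f = concat])

lemma psubst_notin: "v \<notin> set (plabels P) \<Longrightarrow> psubst v g P R = P"
  by (induction P) (auto intro: map_idI)

lemma preplace_notin: "v \<notin> set (plabels P) \<Longrightarrow> preplace v Y P = P"
  by (induction P) (auto intro: map_idI)

lemma pbranches_notin: "v \<notin> set (plabels P) \<Longrightarrow> pbranches v P = []"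
  by (induction P) auto

lemma concat_pbranches_notin:
  "(\<And>X. X \<in> set Ps \<Longrightarrow> v \<notin> set (plabels X)) \<Longrightarrow> concat (map (pbranches v) Ps) = []"
  by (auto simp: pbranches_notin)

text \<open>Distinct labels confine \<open>v\<close> to one branch, so the recursions searching for
  \<open>v\<close> act on that branch and fix its siblings.\<close>

lemma split_branch:
  assumes "distinct (plabels (PNode a Ps))" "v \<in> set (plabels (PNode a Ps))" "v \<noteq> a"
  obtains us Q ws where "Ps = us @ Q # ws" "v \<in> set (plabels Q)" "distinct (plabels Q)"
    "\<And>X. X \<in> set us \<union> set ws \<Longrightarrow> v \<notin> set (plabels X)"
proof -
  from assms obtain Q where "Q \<in> set Ps" "v \<in> set (plabels Q)" by auto
  moreover then obtain us ws where "Ps = us @ Q # ws" by (meson split_list)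
  ultimately show thesis
    using assms by (intro that[of us Q ws]) auto
qed

lemma psubst_eq_preplace:
  assumes "distinct (plabels P)" "v \<in> set (plabels P)"
  shows "psubst v g P R =
    preplace v (pgraft (\<lambda>\<alpha>. filter (\<lambda>U. g (proot U) = \<alpha>) (pbranches v P)) R) P"
  using assms
proof (induction P)
  case (PNode a Ps)
  show ?case
  proof (cases "a = v")
    case False
    obtain us Q ws where "Ps = us @ Q # ws" "v \<in> set (plabels Q)" "distinct (plabels Q)"
      "\<And>X. X \<in> set us \<union> set ws \<Longrightarrow> v \<notin> set (plabels X)"
      using split_branch[OF PNode.prems] False by metis
    moreover have "map (\<lambda>S. psubst v g S R) us = us" "map (\<lambda>S. psubst v g S R) ws = ws"
      "map (preplace v Y) us = us" "map (preplace v Y) ws = ws" for Y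
      using calculation(4) by (auto intro!: map_idI simp: psubst_notin preplace_notin)
    ultimately show ?thesis
      using False PNode.IH[of Q] by (simp add: concat_pbranches_notin)
  qed simp
qed

text \<open>The last move in recovering \<open>P\<close> from a composite: \<open>v\<close> with its
  own branches is put back.\<close>

lemma preplace_pbranches:
  assumes "distinct (plabels P)"
  shows "preplace v (PNode v (pbranches v P)) P = P"
proof (cases "v \<in> set (plabels P)")
  case True
  with assms show ?thesis
  proof (induction P)
    case (PNode a Ps)
    show ?case
    proof (cases "a = v")
      case False
      obtain us Q ws where "Ps = us @ Q # ws" "v \<in> set (plabels Q)" "distinct (plabels Q)"
        "\<And>X. X \<in> set us \<union> set ws \<Longrightarrow> v \<notin> set (plabels X)"
        using split_branch[OF PNode.prems] False by metis
      moreover have "map (preplace v Y) us = us" "map (preplace v Y) ws = ws" for Y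
        using calculation(4) by (auto intro!: map_idI simp: preplace_notin)
      ultimately show ?thesis
        using False PNode.IH[of Q] by (simp add: concat_pbranches_notin)
    qed simp
  qed
qed (simp add: preplace_notin)

text \<open>Finds the graft inside a composite through the label \<open>r\<close> of its root.
  Subtracting \<open>{v}\<close> in the hypothesis on \<open>r\<close> admits \<open>r = v\<close>:
  the inserted tree may reuse the label that the replacement has freed.\<close>

lemma pbranches_preplace:
  assumes "distinct (plabels P)" "v \<in> set (plabels P)" "r \<notin> set (plabels P) - {v}" "proot Y = r"
  shows "pbranches r (preplace v Y P) = pbranches r Y"
  using assms
proof (induction P)
  case (PNode a Ps)
  show ?case
  proof (cases "a = v")
    case False
    obtain us Q ws where *: "Ps = us @ Q # ws" "v \<in> set (plabels Q)" "distinct (plabels Q)"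
      "\<And>X. X \<in> set us \<union> set ws \<Longrightarrow> v \<notin> set (plabels X)"
      using split_branch[OF PNode.prems(1,2)] False by metis
    moreover have "map (preplace v Y) us = us" "map (preplace v Y) ws = ws" for Y
      using *(4) by (auto intro!: map_idI simp: preplace_notin)
    moreover have "r \<notin> set (plabels X)" if "X \<in> set us \<union> set ws" for X
      using PNode.prems(3) *(1,4) that by auto
    moreover have "r \<noteq> a" "r \<notin> set (plabels Q) - {v}"
      using PNode.prems(3) *(1) False by auto
    ultimately show ?thesis
      using False PNode.IH[of Q] PNode.prems(4) by (simp add: concat_pbranches_notin)
  qed simp
qed

text \<open>The search for \<open>r\<close> stops only at the root of an inserted \<open>Y\<close>,
  so a second replacement overwrites \<open>Y\<close> and undoes the first.\<close>

lemma preplace_preplace: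
  assumes "r \<notin> set (plabels P) - {v}" "proot Y = r"
  shows "preplace r X (preplace v Y P) = preplace v X P"
proof -
  obtain Ys where "Y = PNode r Ys" using assms(2) by (cases Y) auto
  with assms(1) show ?thesis by (induction P) auto
qed


section \<open>Grafting and cutting\<close>

text \<open>\<open>fangles\<close> and \<open>fgraft\<close> treat the list of children of \<open>b\<close> recursively; \<open>j\<close> is the index of the
  angle preceding the list.\<close>

primrec fangles :: "'a \<Rightarrow> nat \<Rightarrow> 'a ptree list \<Rightarrow> ('a \<times> nat) list" where
  "fangles b j [] = []"
| "fangles b j (U # Us) = angles U @ (b, Suc j) # fangles b (Suc j) Us"

primrec fgraft ::
  "('a \<times> nat \<Rightarrow> 'a ptree list) \<Rightarrow> 'a \<Rightarrow> nat \<Rightarrow> 'a ptree list \<Rightarrow> 'a ptree list" where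
  "fgraft h b j [] = []"
| "fgraft h b j (U # Us) = pgraft h U # h (b, Suc j) @ fgraft h b (Suc j) Us"

text \<open>Induction needs an arbitrary starting index \<open>j\<close> in place of 0. The
  recursive forms then replace the defining equations as simplification rules.\<close>

lemma angles_PNode: "angles (PNode b Us) = (b, 0) # fangles b 0 Us"
proof -
  have "concat (map2 (\<lambda>i as. as @ [(b, Suc i)]) [j..<j + length Us] (map angles Us)) = fangles b j Us"
    for j
  proof (induction Us arbitrary: j)
    case (Cons U Us)
    show ?case using Cons[of "Suc j"] by (simp add: upt_conv_Cons del: upt_Suc)
  qed simp
  from this[of 0] show ?thesis by simp
qed

lemma pgraft_PNode: "pgraft h (PNode b Us) = PNode b (h (b, 0) @ fgraft h b 0 Us)"
proof -
  have "concat (map2 (\<lambda>i U. U # h (b, Suc i)) [j..<j + length Us] (map (pgraft h) Us)) = fgraft h b j Us"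
    for j
  proof (induction Us arbitrary: j)
    case (Cons U Us)
    show ?case using Cons[of "Suc j"] by (simp add: upt_conv_Cons del: upt_Suc)
  qed simp
  from this[of 0] show ?thesis by simp
qed

declare angles.simps [simp del] pgraft.simps [simp del]
declare angles_PNode [simp] pgraft_PNode [simp]

lemma proot_pgraft [simp]: "proot (pgraft h R) = proot R"
  by (cases R) simp

lemma fangles_append: "fangles b j (us @ ws) = fangles b j us @ fangles b (j + length us) ws"
  by (induction us arbitrary: j) auto

text \<open>Later angles at \<open>b\<close> have strictly larger indices; together with distinct
  labels this separates them from every angle already passed.\<close>

lemma fangles_bound:
  assumes "\<And>U. U \<in> set Us \<Longrightarrow> fst ` set (angles U) = set (plabels U)"
    and "\<alpha> \<in> set (fangles b j Us)"
  shows "fst \<alpha> = b \<and> j < snd \<alpha> \<or> fst \<alpha> \<in> (\<Union>U\<in>set Us. set (plabels U))"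
  using assms
proof (induction Us arbitrary: j)
  case (Cons U Us)
  have 1: "fst ` set (angles U) = set (plabels U)" using Cons.prems(1) by simp
  from Cons.prems(2) consider "\<alpha> \<in> set (angles U)" | "\<alpha> = (b, Suc j)" | "\<alpha> \<in> set (fangles b (Suc j) Us)"
    by auto
  then show ?case
  proof cases
    case 1
    then have "fst \<alpha> \<in> set (plabels U)" using Cons.prems(1)[of U] by auto
    then show ?thesis by simp
  next
    case 3
    have "fst ` set (angles X) = set (plabels X)" if "X \<in> set Us" for X
      using Cons.prems(1) that by simp
    from Cons.IH[OF this 3] show ?thesis by auto
  qed simp
qed simp

lemma fst_angles: "fst ` set (angles R) = set (plabels R)"
proof (induction R)
  case (PNode b Us)
  \<comment> \<open>Adding \<open>b\<close> on both sides absorbs the angles at \<open>b\<close>, of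
    which an empty forest has none.\<close>
  have "insert b (fst ` set (fangles b j Us)) = insert b (\<Union>U\<in>set Us. set (plabels U))" for j
    using PNode
  proof (induction Us arbitrary: j)
    case (Cons U Us)
    have "insert b (fst ` set (fangles b (Suc j) Us)) = insert b (\<Union>U\<in>set Us. set (plabels U))"
      using Cons by simp
    moreover have "fst ` set (angles U) = set (plabels U)" using Cons.prems by simp
    ultimately show ?case by (auto simp: image_Un)
  qed simp
  then show ?case by simp
qed

text \<open>Grafting functions and the order of angles address an angle by its value, which
  identifies a position only without repetitions.\<close>

lemma distinct_angles: "distinct (plabels R) \<Longrightarrow> distinct (angles R)"
proof (induction R)
  case (PNode b Us)
  have "distinct (fangles b j Us)" for j
    using PNode
  proof (induction Us arbitrary: j)
    case (Cons U Us)
    have *: "fst \<alpha> = b \<and> Suc j < snd \<alpha> \<or> fst \<alpha> \<in> (\<Union>U\<in>set Us. set (plabels U))"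
      if "\<alpha> \<in> set (fangles b (Suc j) Us)" for \<alpha>
      using fangles_bound[OF fst_angles that] .
    have labels: "b \<notin> set (plabels U)" "b \<notin> (\<Union>U\<in>set Us. set (plabels U))"
      "set (plabels U) \<inter> (\<Union>U\<in>set Us. set (plabels U)) = {}"
      using Cons.prems(2) by auto
    have U: "fst \<alpha> \<in> set (plabels U)" if "\<alpha> \<in> set (angles U)" for \<alpha>
      using that fst_angles[of U] by blast
    have "(b, Suc j) \<notin> set (angles U)" "(b, Suc j) \<notin> set (fangles b (Suc j) Us)"
      using U[of "(b, Suc j)"] *[of "(b, Suc j)"] labels by auto
    moreover have False if "\<alpha> \<in> set (angles U)" "\<alpha> \<in> set (fangles b (Suc j) Us)" for \<alpha>
      using U[OF that(1)] *[OF that(2)] labels by auto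
    moreover have "distinct (angles U)" "distinct (fangles b (Suc j) Us)"
      using Cons by simp_all
    ultimately show ?case by (auto simp del: angles_PNode)
  qed simp
  moreover have "(b, 0) \<notin> set (fangles b 0 Us)"
    using fangles_bound[OF fst_angles, of "(b, 0)" b 0 Us] PNode.prems by auto
  ultimately show ?case by simp
qed

text \<open>The first hypothesis is the congruence for single branches; the induction in
  \<open>pgraft_cong\<close> provides it, and \<open>fgraft_cong\<close> discharges it
  afterwards.\<close>

lemma fgraft_cong_aux:
  assumes "\<And>U h h'. U \<in> set Us \<Longrightarrow> (\<And>\<alpha>. \<alpha> \<in> set (angles U) \<Longrightarrow> h \<alpha> = h' \<alpha>) \<Longrightarrow> pgraft h U = pgraft h' U"
    and "\<And>\<alpha>. \<alpha> \<in> set (fangles b j Us) \<Longrightarrow> h \<alpha> = h' \<alpha>"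
  shows "fgraft h b j Us = fgraft h' b j Us"
  using assms
proof (induction Us arbitrary: j)
  case (Cons U Us)
  have "pgraft h U = pgraft h' U"
    by (rule Cons.prems(1)) (auto intro: Cons.prems(2))
  moreover have "fgraft h b (Suc j) Us = fgraft h' b (Suc j) Us"
  proof (rule Cons.IH)
    show "pgraft h U = pgraft h' U"
      if "U \<in> set Us" "\<And>\<alpha>. \<alpha> \<in> set (angles U) \<Longrightarrow> h \<alpha> = h' \<alpha>" for U h h'
      using that by (intro Cons.prems(1)) auto
    show "h \<alpha> = h' \<alpha>" if "\<alpha> \<in> set (fangles b (Suc j) Us)" for \<alpha>
      using that by (intro Cons.prems(2)) simp
  qed
  ultimately show ?case using Cons.prems(2)[of "(b, Suc j)"] by simp
qed (simp only: fgraft.simps)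

lemma pgraft_cong:
  "(\<And>\<alpha>. \<alpha> \<in> set (angles R) \<Longrightarrow> h \<alpha> = h' \<alpha>) \<Longrightarrow> pgraft h R = pgraft h' R"
proof (induction R arbitrary: h h')
  case (PNode b Us)
  have "fgraft h b 0 Us = fgraft h' b 0 Us"
  proof (rule fgraft_cong_aux)
    show "h \<alpha> = h' \<alpha>" if "\<alpha> \<in> set (fangles b 0 Us)" for \<alpha>
      using that by (intro PNode.prems) simp
  qed (rule PNode.IH)
  then show ?case using PNode.prems[of "(b, 0)"] by simp
qed

lemmas fgraft_cong = fgraft_cong_aux[OF pgraft_cong]

text \<open>Vertices in \<open>C\<close> are the roots of the grafted branches. \<open>prune C\<close> removes these branches, and
  \<open>cuts C\<close> lists them in increasing order of angles, each with the angle of the pruned tree it was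
  plugged into.\<close>

fun prune :: "'a set \<Rightarrow> 'a ptree \<Rightarrow> 'a ptree" where
  "prune C (PNode b Ys) = PNode b (map (prune C) (filter (\<lambda>U. proot U \<notin> C) Ys))"

fun cuts :: "'a set \<Rightarrow> 'a ptree \<Rightarrow> (('a \<times> nat) \<times> 'a ptree) list"
  and fcuts :: "'a set \<Rightarrow> 'a \<Rightarrow> nat \<Rightarrow> 'a ptree list \<Rightarrow> (('a \<times> nat) \<times> 'a ptree) list" where
  "cuts C (PNode b Ys) = fcuts C b 0 Ys"
| "fcuts C b j [] = []"
| "fcuts C b j (U # Us) =
    (if proot U \<in> C then ((b, j), U) # fcuts C b j Us else cuts C U @ fcuts C b (Suc j) Us)"

text \<open>Grafted branches do not advance the index \<open>j\<close>: they all sit in one angle of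
  the pruned tree.\<close>

lemma fcuts_append:
  "(\<And>U. U \<in> set F \<Longrightarrow> proot U \<in> C) \<Longrightarrow> fcuts C b j (F @ Us) = map (Pair (b, j)) F @ fcuts C b j Us"
  by (induction F) auto

text \<open>The vertices of \<open>R\<close> lie outside \<open>C\<close> and cut branches are not
  entered, so the scan cuts exactly the grafts and, passing through \<open>R\<close> from left to
  right, meets its angles in their order.\<close>

lemma cuts_pgraft:
  assumes "\<And>\<alpha> U. U \<in> set (h \<alpha>) \<Longrightarrow> proot U \<in> C"
    and "set (plabels R) \<inter> C = {}"
  shows "cuts C (pgraft h R) = concat (map (\<lambda>\<alpha>. map (Pair \<alpha>) (h \<alpha>)) (angles R))"
  using assms(2)
proof (induction R)
  case (PNode b Us)
  have "fcuts C b j (fgraft h b j Us) = concat (map (\<lambda>\<alpha>. map (Pair \<alpha>) (h \<alpha>)) (fangles b j Us))" for j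
    using PNode
  proof (induction Us arbitrary: j)
    case (Cons U Us)
    have "proot U \<in> set (plabels (PNode b (U # Us)))" by simp
    then have "proot U \<notin> C" using Cons.prems(2) by blast
    moreover have "fcuts C b (Suc j) (h (b, Suc j) @ fgraft h b (Suc j) Us) =
        map (Pair (b, Suc j)) (h (b, Suc j)) @ fcuts C b (Suc j) (fgraft h b (Suc j) Us)"
      by (rule fcuts_append) (rule assms(1))
    moreover have "fcuts C b (Suc j) (fgraft h b (Suc j) Us) =
        concat (map (\<lambda>\<alpha>. map (Pair \<alpha>) (h \<alpha>)) (fangles b (Suc j) Us))"
      using Cons by (intro Cons.IH) auto
    moreover have "cuts C (pgraft h U) = concat (map (\<lambda>\<alpha>. map (Pair \<alpha>) (h \<alpha>)) (angles U))"
      using Cons.prems by auto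
    ultimately show ?case by simp
  qed simp
  moreover have "fcuts C b 0 (h (b, 0) @ fgraft h b 0 Us) =
      map (Pair (b, 0)) (h (b, 0)) @ fcuts C b 0 (fgraft h b 0 Us)"
    by (rule fcuts_append) (rule assms(1))
  ultimately show ?case by simp
qed

lemma prune_pgraft:
  assumes "\<And>\<alpha> U. U \<in> set (h \<alpha>) \<Longrightarrow> proot U \<in> C"
    and "set (plabels R) \<inter> C = {}"
  shows "prune C (pgraft h R) = R"
  using assms(2)
proof (induction R)
  case (PNode b Us)
  have F: "filter (\<lambda>U. proot U \<notin> C) (h \<alpha>) = []" for \<alpha>
    using assms(1) by auto
  have "map (prune C) (filter (\<lambda>U. proot U \<notin> C) (fgraft h b j Us)) = Us" for j
    using PNode
  proof (induction Us arbitrary: j)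
    case (Cons U Us)
    have "proot U \<in> set (plabels (PNode b (U # Us)))" by simp
    then have "proot U \<notin> C" using Cons.prems(2) by blast
    with Cons show ?case by (auto simp: F)
  qed simp
  then show ?case by (simp add: F)
qed

lemma plabels_prune: "set (plabels (prune C Y)) \<subseteq> set (plabels Y)"
  by (induction C Y rule: prune.induct) auto

text \<open>The bound is weak, in contrast to \<open>fangles_bound\<close>: branches standing before
  the first kept child are plugged into the angle \<open>(b, j)\<close> itself.\<close>

lemma cuts_keys:
  "x \<in> set (cuts C Y) \<Longrightarrow> fst (fst x) \<in> set (plabels Y)"
  "x \<in> set (fcuts C b j Us) \<Longrightarrow> fst (fst x) = b \<and> j \<le> snd (fst x) \<or> fst (fst x) \<in> (\<Union>U\<in>set Us. set (plabels U))"
  by (induction C Y and C b j Us rule: cuts_fcuts.induct) (auto split: if_splits)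

text \<open>Turns a list of cuts back into a grafting function.\<close>

definition select :: "(('a \<times> nat) \<times> 'a ptree) list \<Rightarrow> 'a \<times> nat \<Rightarrow> 'a ptree list" where
  "select pl \<alpha> = map snd (filter (\<lambda>x. fst x = \<alpha>) pl)"

lemma select_append: "select (pl @ ql) \<alpha> = select pl \<alpha> @ select ql \<alpha>"
  by (simp add: select_def)

lemma select_Nil: "(\<And>x. x \<in> set pl \<Longrightarrow> fst x \<noteq> \<alpha>) \<Longrightarrow> select pl \<alpha> = []"
  by (simp add: select_def)

lemma pgraft_cuts:
  "distinct (plabels Y) \<Longrightarrow> pgraft (select (cuts C Y)) (prune C Y) = Y"
proof (induction Y)
  case (PNode b Ys)
  \<comment> \<open>At \<open>b\<close>, \<open>fgraft\<close> fills only the angles of index above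
    \<open>j\<close>, hence the separate block at \<open>(b, j)\<close>; for \<open>j = 0\<close> it
    is the leading forest in \<open>pgraft\<close>.\<close>
  have "select (fcuts C b j Ys) (b, j) @
      fgraft (select (fcuts C b j Ys)) b j (map (prune C) (filter (\<lambda>U. proot U \<notin> C) Ys)) = Ys" for j
    using PNode
  proof (induction Ys arbitrary: j)
    case (Cons U Us)
    let ?Us = "map (prune C) (filter (\<lambda>U. proot U \<notin> C) Us)"
    have IH: "select (fcuts C b j Us) (b, j) @ fgraft (select (fcuts C b j Us)) b j ?Us = Us" for j
      using Cons.prems by (intro Cons.IH) auto
    have labels: "b \<notin> set (plabels U)" "b \<notin> (\<Union>U\<in>set Us. set (plabels U))"
      "set (plabels U) \<inter> (\<Union>U\<in>set Us. set (plabels U)) = {}"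
      using Cons.prems(2) by auto
    have fa: "fst \<alpha> = b \<and> j < snd \<alpha> \<or> fst \<alpha> \<in> (\<Union>U\<in>set Us. set (plabels U))"
      if "\<alpha> \<in> set (fangles b j ?Us)" for \<alpha> j
      using fangles_bound[OF fst_angles that] plabels_prune[of C] by auto
    show ?case
    proof (cases "proot U \<in> C")
      case True
      have "fgraft (select (((b, j), U) # fcuts C b j Us)) b j ?Us =
          fgraft (select (fcuts C b j Us)) b j ?Us"
      proof (rule fgraft_cong)
        fix \<alpha> assume "\<alpha> \<in> set (fangles b j ?Us)"
        from fa[OF this] labels have "(b, j) \<noteq> \<alpha>" by auto
        then show "select (((b, j), U) # fcuts C b j Us) \<alpha> = select (fcuts C b j Us) \<alpha>"
          by (simp add: select_def)
      qed
      moreover have "select (((b, j), U) # fcuts C b j Us) (b, j) = U # select (fcuts C b j Us) (b, j)"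
        by (simp add: select_def)
      ultimately show ?thesis using True IH[of j] by simp
    next
      case False
      let ?h = "select (cuts C U @ fcuts C b (Suc j) Us)"
      have cU: "select (cuts C U) \<alpha> = []" if "fst \<alpha> \<notin> set (plabels U)" for \<alpha>
      proof (rule select_Nil)
        fix x assume "x \<in> set (cuts C U)"
        from cuts_keys(1)[OF this] that show "fst x \<noteq> \<alpha>" by auto
      qed
      have "select (fcuts C b (Suc j) Us) (b, j) = []"
      proof (rule select_Nil)
        fix x assume "x \<in> set (fcuts C b (Suc j) Us)"
        from cuts_keys(2)[OF this] labels show "fst x \<noteq> (b, j)" by (cases "fst x") auto
      qed
      then have "?h (b, j) = []"
        using labels by (simp add: select_append cU)
      \<comment> \<open>Cuts inside \<open>U\<close> and cuts to the right of \<open>U\<close> carry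
        angles at different vertices, as labels are distinct; each half of the list governs its own
        part.\<close>
      moreover have "pgraft ?h (prune C U) = pgraft (select (cuts C U)) (prune C U)"
      proof (rule pgraft_cong)
        fix \<alpha> assume "\<alpha> \<in> set (angles (prune C U))"
        then have \<alpha>: "fst \<alpha> \<in> set (plabels U)"
          using fst_angles[of "prune C U"] plabels_prune[of C U] by blast
        have "select (fcuts C b (Suc j) Us) \<alpha> = []"
        proof (rule select_Nil)
          fix x assume "x \<in> set (fcuts C b (Suc j) Us)"
          from cuts_keys(2)[OF this] labels \<alpha> show "fst x \<noteq> \<alpha>" by auto
        qed
        then show "?h \<alpha> = select (cuts C U) \<alpha>" by (simp add: select_append)
      qed
      moreover have "pgraft (select (cuts C U)) (prune C U) = U"
        using Cons.prems by auto
      moreover have "?h (b, Suc j) = select (fcuts C b (Suc j) Us) (b, Suc j)"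
        using labels by (simp add: select_append cU)
      moreover have "fgraft ?h b (Suc j) ?Us = fgraft (select (fcuts C b (Suc j) Us)) b (Suc j) ?Us"
      proof (rule fgraft_cong)
        fix \<alpha> assume "\<alpha> \<in> set (fangles b (Suc j) ?Us)"
        from fa[OF this] labels have "fst \<alpha> \<notin> set (plabels U)" by auto
        then show "?h \<alpha> = select (fcuts C b (Suc j) Us) \<alpha>"
          by (simp add: select_append cU)
      qed
      ultimately show ?thesis
        using False IH[of "Suc j"] by simp
    qed
  qed (simp add: select_def)
  from this[of 0] show ?case by simp
qed

lemma distinct_concat_mono:
  assumes "distinct (concat (map f xs))" "\<And>x. x \<in> set xs \<Longrightarrow> distinct (g x) \<and> set (g x) \<subseteq> set (f x)"
  shows "distinct (concat (map g (filter Q xs)))"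
  using assms
proof (induction xs)
  case (Cons x xs)
  have "set (concat (map g (filter Q xs))) \<subseteq> set (concat (map f xs))"
    using Cons.prems(2) by fastforce
  moreover have "set (g x) \<subseteq> set (f x)" "distinct (g x)" using Cons.prems(2) by auto
  moreover have "set (f x) \<inter> set (concat (map f xs)) = {}" using Cons.prems(1) by auto
  ultimately have "set (g x) \<inter> set (concat (map g (filter Q xs))) = {}" by blast
  moreover have "distinct (concat (map g (filter Q xs)))"
    using Cons by simp
  ultimately show ?case using \<open>distinct (g x)\<close> by simp
qed simp

lemma distinct_plabels_prune: "distinct (plabels Y) \<Longrightarrow> distinct (plabels (prune C Y))"
proof (induction Y)
  case (PNode b Ys)
  have "distinct (concat (map (\<lambda>U. plabels (prune C U)) (filter (\<lambda>U. proot U \<notin> C) Ys)))"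
  proof (rule distinct_concat_mono[of plabels])
    fix U assume U: "U \<in> set Ys"
    then have "distinct (plabels U)" using PNode.prems by (auto dest!: split_list)
    from PNode.IH[OF U this] plabels_prune[of C U]
    show "distinct (plabels (prune C U)) \<and> set (plabels (prune C U)) \<subseteq> set (plabels U)" ..
  qed (use PNode.prems in simp)
  moreover have "b \<notin> set (plabels (prune C U))" if "U \<in> set Ys" for U
    using that PNode.prems plabels_prune[of C U] by auto
  ultimately show ?case by (auto simp: comp_def)
qed


section \<open>Increasing maps\<close>

text \<open>The relation \<open>angle_le\<close> for a general list, which makes induction on the
  list available.\<close>

definition precedes :: "'b list \<Rightarrow> 'b \<Rightarrow> 'b \<Rightarrow> bool" where
  "precedes as x y \<longleftrightarrow> (\<exists>i j. i \<le> j \<and> j < length as \<and> as ! i = x \<and> as ! j = y)"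

lemma precedes_Nil [simp]: "\<not> precedes [] x y"
  by (simp add: precedes_def)

lemma precedes_Cons: "precedes (a # as) x y \<longleftrightarrow> x = a \<and> y \<in> set (a # as) \<or> precedes as x y"
proof
  assume "precedes (a # as) x y"
  then obtain i j where ij: "i \<le> j" "j < length (a # as)" "(a # as) ! i = x" "(a # as) ! j = y"
    unfolding precedes_def by blast
  show "x = a \<and> y \<in> set (a # as) \<or> precedes as x y"
  proof (cases i)
    case 0
    then show ?thesis using ij nth_mem[of j "a # as"] by auto
  next
    case (Suc i')
    then obtain j' where "j = Suc j'" using ij(1) by (cases j) auto
    with Suc ij show ?thesis by (auto simp: precedes_def)
  qed
next
  assume "x = a \<and> y \<in> set (a # as) \<or> precedes as x y"
  then show "precedes (a # as) x y"
  proof (elim disjE conjE)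
    assume "x = a" "y \<in> set (a # as)"
    then show ?thesis unfolding precedes_def by (metis in_set_conv_nth le0 nth_Cons_0)
  next
    assume "precedes as x y"
    then obtain i j where "i \<le> j" "j < length as" "as ! i = x" "as ! j = y"
      unfolding precedes_def by blast
    then show ?thesis
      unfolding precedes_def by (intro exI[of _ "Suc i"] exI[of _ "Suc j"]) simp
  qed
qed

lemma precedes_in_set: "precedes as x y \<Longrightarrow> x \<in> set as \<and> y \<in> set as"
  by (auto simp: precedes_def)

lemma filter_first:
  assumes "sorted_wrt Q (map k xs)" "\<And>x. Q x a \<Longrightarrow> x = a"
  shows "filter (\<lambda>x. k x = a) xs @ filter (\<lambda>x. k x \<noteq> a) xs = xs"
  using assms(1)
proof (induction xs)
  case (Cons x xs)
  show ?case
  proof (cases "k x = a")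
    case False
    have "k y \<noteq> a" if "y \<in> set xs" for y
      using that Cons.prems assms(2)[of "k x"] False by auto
    then have "filter (\<lambda>x. k x = a) xs = []" by simp
    with False Cons show ?thesis by simp
  qed (use Cons in simp)
qed simp

text \<open>Grouping by keys in the order \<open>as\<close> is a stable sort and leaves a sorted
  list alone. Applied to the branches at \<open>v\<close>, this is where monotonicity enters:
  grafting loses no information on their order.\<close>

lemma concat_filter_sorted:
  assumes "distinct as" "k ` set xs \<subseteq> set as" "sorted_wrt (precedes as) (map k xs)"
  shows "concat (map (\<lambda>a. filter (\<lambda>x. k x = a) xs) as) = xs"
  using assms
proof (induction as arbitrary: xs)
  case (Cons a as)
  let ?ys = "filter (\<lambda>x. k x \<noteq> a) xs"
  have "sorted_wrt (precedes (a # as)) (map k ?ys)"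
    using Cons.prems(3) by (simp add: sorted_wrt_map sorted_wrt_filter)
  then have "sorted_wrt (precedes as) (map k ?ys)"
    unfolding sorted_wrt_map by (rule sorted_wrt_mono_rel[rotated]) (auto simp: precedes_Cons)
  then have "concat (map (\<lambda>b. filter (\<lambda>x. k x = b) ?ys) as) = ?ys"
    using Cons.prems by (intro Cons.IH) auto
  moreover have "map (\<lambda>b. filter (\<lambda>x. k x = b) ?ys) as = map (\<lambda>b. filter (\<lambda>x. k x = b) xs) as"
    using Cons.prems(1) by (auto intro!: filter_cong)
  ultimately have "concat (map (\<lambda>b. filter (\<lambda>x. k x = b) xs) as) = ?ys"
    by metis
  \<comment> \<open>Since \<open>a\<close> heads a list without repetitions, only \<open>a\<close>
    precedes it; the entries with key \<open>a\<close> therefore come first.\<close>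
  moreover have "x = a" if "precedes (a # as) x a" for x
    using that Cons.prems(1) precedes_in_set[of as x a] by (auto simp: precedes_Cons)
  ultimately show ?case
    using filter_first[OF Cons.prems(3), of a] by simp
qed simp

text \<open>The converse direction: keys are equal within a block and follow the order of
  \<open>as\<close> from one block to the next.\<close>

lemma sorted_concat_blocks:
  "sorted_wrt (precedes as) (map fst (concat (map (\<lambda>a. map (Pair a) (h a)) as)))"
proof (induction as)
  case (Cons a as)
  have "sorted_wrt (precedes (a # as)) (map fst (concat (map (\<lambda>a. map (Pair a) (h a)) as)))"
    using Cons by (rule sorted_wrt_mono_rel[rotated]) (auto simp: precedes_Cons)
  moreover have "sorted_wrt (precedes (a # as)) (map fst (map (Pair a) xs))" for xs :: "'b list"
    by (induction xs) (auto simp: precedes_Cons)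
  moreover have "precedes (a # as) a b" if "b \<in> set as" for b
    using that by (simp add: precedes_Cons)
  ultimately show ?case
    by (auto simp: sorted_wrt_append simp del: map_map)
qed simp

lemma angle_le_eq: "angle_le T = precedes (angles T)"
  by (intro ext) (simp add: angle_le_def precedes_def)


section \<open>Forgetting the planar structure\<close>

primrec rbranches :: "'a \<Rightarrow> 'a rtree \<Rightarrow> 'a rtree multiset" where
  "rbranches v (RNode a M) = (if a = v then M else \<Sum>\<^sub># (image_mset (rbranches v) M))"

lemma redges_eq: "redges v S = image_mset rroot (rbranches v S)"
proof (induction S)
  case (RNode a M)
  then have "image_mset (redges v) M = image_mset (\<lambda>U. image_mset rroot (rbranches v U)) M"
    by (intro image_mset_cong) auto
  moreover have "image_mset rroot (\<Sum>\<^sub># (image_mset (rbranches v) M)) =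
      \<Sum>\<^sub># (image_mset (\<lambda>U. image_mset rroot (rbranches v U)) M)"
    by (induction M) auto
  ultimately show ?case by simp
qed

lemma rbranches_notin: "v \<notin># rlabels S \<Longrightarrow> rbranches v S = {#}"
  by (induction S) auto

lemma rsubst_notin: "v \<notin># rlabels S \<Longrightarrow> rsubst v f S T = S"
proof (induction S)
  case (RNode a M)
  then have "image_mset (\<lambda>S. rsubst v f S T) M = image_mset (\<lambda>S. S) M"
    by (intro image_mset_cong) auto
  with RNode.prems show ?case by auto
qed

lemma forget_pbranches: "mset (map forget (pbranches v P)) = rbranches v (forget P)"
proof (induction P)
  case (PNode a Ps)
  have "mset (map forget (concat (map (pbranches v) Ps))) =
      \<Sum>\<^sub># (image_mset (\<lambda>P. rbranches v (forget P)) (mset Ps))"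
    using PNode by (induction Ps) auto
  then show ?case by (simp add: image_mset.compositionality comp_def)
qed

lemma rlabels_rbranches: "U \<in># rbranches v S \<Longrightarrow> set_mset (rlabels U) \<subseteq> set_mset (rlabels S)"
  by (induction S) (fastforce split: if_splits)

lemma split_rbranch:
  assumes "nodup (rlabels (RNode a M))" "v \<in># rlabels (RNode a M)" "v \<noteq> a"
  obtains S M' where "M = add_mset S M'" "v \<in># rlabels S" "nodup (rlabels S)"
    "v \<notin># \<Sum>\<^sub># (image_mset rlabels M')"
proof -
  from assms obtain S where "S \<in># M" and v: "v \<in># rlabels S" by auto
  then obtain M' where M: "M = add_mset S M'" by (meson multi_member_split)
  with assms have "nodup (rlabels S + \<Sum>\<^sub># (image_mset rlabels M'))"
    by (simp add: nodup_add_mset)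
  with M v show thesis by (intro that[of S M']) (auto simp: nodup_add)
qed

lemma image_rbranches_notin:
  assumes "v \<notin># \<Sum>\<^sub># (image_mset rlabels M)"
  shows "\<Sum>\<^sub># (image_mset (rbranches v) M) = {#}" "image_mset (\<lambda>S. rsubst v f S T) M = M"
proof -
  have "image_mset (rbranches v) M = image_mset (\<lambda>_. {#}) M"
    using assms by (intro image_mset_cong rbranches_notin) auto
  then show "\<Sum>\<^sub># (image_mset (rbranches v) M) = {#}" by simp
  have "image_mset (\<lambda>S. rsubst v f S T) M = image_mset (\<lambda>S. S) M"
    using assms by (intro image_mset_cong rsubst_notin) auto
  then show "image_mset (\<lambda>S. rsubst v f S T) M = M" by simp
qed

lemma notin_rbranches:
  assumes "nodup (rlabels S)" "U \<in># rbranches v S"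
  shows "v \<notin># rlabels U"
  using assms
proof (induction S)
  case (RNode a M)
  show ?case
  proof (cases "v = a")
    case True
    then show ?thesis using RNode.prems by (auto simp: nodup_add_mset)
  next
    case False
    show ?thesis
    proof (cases "v \<in># rlabels (RNode a M)")
      case True
      obtain S M' where S: "M = add_mset S M'" "v \<in># rlabels S" "nodup (rlabels S)"
        "v \<notin># \<Sum>\<^sub># (image_mset rlabels M')"
        using split_rbranch[OF RNode.prems(1) True False] .
      then have "U \<in># rbranches v S"
        using RNode.prems(2) False by (simp add: image_rbranches_notin(1)[OF S(4)])
      with S show ?thesis by (intro RNode.IH[of S]) auto
    next
      case False
      with RNode.prems show ?thesis by (simp add: rbranches_notin del: rbranches.simps)
    qed
  qed
qed

lemma nodup_rbranches:
  assumes "nodup (rlabels S)"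
  shows "nodup (\<Sum>\<^sub># (image_mset rlabels (rbranches v S)))"
proof (cases "v \<in># rlabels S")
  case True
  with assms show ?thesis
  proof (induction S)
    case (RNode a M)
    show ?case
    proof (cases "v = a")
      case True
      then show ?thesis using RNode.prems by (auto simp: nodup_add_mset)
    next
      case False
      obtain S M' where "M = add_mset S M'" "v \<in># rlabels S" "nodup (rlabels S)"
        "v \<notin># \<Sum>\<^sub># (image_mset rlabels M')"
        using split_rbranch[OF RNode.prems False] .
      with RNode False show ?thesis by (auto simp: image_rbranches_notin)
    qed
  qed
next
  case False
  then show ?thesis by (simp add: rbranches_notin nodup_def)
qed

text \<open>Edges are named by the roots of the branches, and the branches at \<open>v\<close> have
  disjoint labels.\<close>

lemma nodup_redges:
  assumes "nodup (rlabels S)"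
  shows "nodup (redges v S)"
proof -
  have "image_mset rroot M \<subseteq># \<Sum>\<^sub># (image_mset rlabels M)" for M :: "'a rtree multiset"
  proof (induction M)
    case (add U M)
    have "{#rroot U#} \<subseteq># rlabels U" by simp
    from subset_mset.add_mono[OF this add] show ?case by simp
  qed simp
  then show ?thesis
    unfolding redges_eq using nodup_mono nodup_rbranches[OF assms] by blast
qed

lemma rroot_rgraft [simp]: "rroot (rgraft G T) = rroot T"
  by (cases T) simp

lemma filter_mset_cong_fun:
  "(\<And>U. U \<in># M \<Longrightarrow> f (k U) = g (k U)) \<Longrightarrow> {#U \<in># M. f (k U) = b#} = {#U \<in># M. g (k U) = b#}"
  by (rule filter_mset_cong) auto

text \<open>Justifies passing to maps that are extensional on the edges.\<close>

lemma rsubst_cong: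
  "(\<And>c. c \<in># redges v S \<Longrightarrow> f c = f' c) \<Longrightarrow> rsubst v f S T = rsubst v f' S T"
proof (induction S)
  case (RNode a M)
  show ?case
  proof (cases "a = v")
    case True
    with RNode.prems have "{#U \<in># M. f (rroot U) = b#} = {#U \<in># M. f' (rroot U) = b#}" for b
      by (intro filter_mset_cong_fun) auto
    with True show ?thesis by simp
  next
    case False
    have "image_mset (\<lambda>S. rsubst v f S T) M = image_mset (\<lambda>S. rsubst v f' S T) M"
    proof (rule image_mset_cong)
      fix U assume U: "U \<in># M"
      show "rsubst v f U T = rsubst v f' U T"
        by (rule RNode.IH[OF U]) (use U RNode.prems False in auto)
    qed
    with False show ?thesis by simp
  qed
qed

section \<open>Grafting seen on non-planar trees\<close>

lemma filter_angles_child: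
  assumes "distinct (plabels (PNode b Us))" "U \<in> set Us" "c \<in> set (plabels U)"
  shows "filter (\<lambda>\<alpha>. fst \<alpha> = c) (angles (PNode b Us)) = filter (\<lambda>\<alpha>. fst \<alpha> = c) (angles U)"
proof -
  from assms(2) obtain us ws where Us: "Us = us @ U # ws" by (meson split_list)
  have *: "filter (\<lambda>\<alpha>. fst \<alpha> = c) (fangles b j Vs) = []" if "set Vs \<subseteq> set us \<union> set ws" for j Vs
  proof -
    have "c \<notin> set (plabels X)" if "X \<in> set us \<union> set ws" for X
      using that assms(1,3) Us by auto
    moreover have "c \<noteq> b" using assms by auto
    ultimately have "fst \<alpha> \<noteq> c" if "\<alpha> \<in> set (fangles b j Vs)" for \<alpha>
      using fangles_bound[OF fst_angles that] \<open>set Vs \<subseteq> _\<close> by blast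
    then show ?thesis by simp
  qed
  have "c \<noteq> b" using assms by auto
  then show ?thesis by (simp add: Us fangles_append *)
qed

lemma forget_fgraft:
  assumes "b \<notin> (\<Union>U\<in>set Us. set (plabels U))"
  shows "mset (map forget (fgraft h b j Us)) =
    mset (map forget (concat (map h (filter (\<lambda>\<alpha>. fst \<alpha> = b) (fangles b j Us))))) +
    image_mset (\<lambda>U. forget (pgraft h U)) (mset Us)"
  using assms
proof (induction Us arbitrary: j)
  case (Cons U Us)
  have "fst \<alpha> \<noteq> b" if "\<alpha> \<in> set (angles U)" for \<alpha>
    using that Cons.prems fst_angles[of U] by auto
  then have "filter (\<lambda>\<alpha>. fst \<alpha> = b) (angles U) = []" by simp
  with Cons show ?case by simp
qed simp

text \<open>All angles at one vertex merge when the order is forgotten, so \<open>G b\<close>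
  gathers the branches from every angle at \<open>b\<close>.\<close>

lemma forget_pgraft:
  assumes "distinct (plabels R)"
    and "\<And>b. b \<in> set (plabels R) \<Longrightarrow>
      G b = mset (map forget (concat (map h (filter (\<lambda>\<alpha>. fst \<alpha> = b) (angles R)))))"
  shows "forget (pgraft h R) = rgraft G (forget R)"
  using assms
proof (induction R)
  case (PNode b Us)
  have b: "b \<notin> (\<Union>U\<in>set Us. set (plabels U))" using PNode.prems(1) by auto
  have "image_mset (\<lambda>U. forget (pgraft h U)) (mset Us) = image_mset (\<lambda>U. rgraft G (forget U)) (mset Us)"
  proof (rule image_mset_cong)
    fix U assume "U \<in># mset Us"
    then have U: "U \<in> set Us" by simp
    show "forget (pgraft h U) = rgraft G (forget U)"
    proof (rule PNode.IH[OF U])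
      show "distinct (plabels U)" using PNode.prems(1) U by (auto dest!: split_list)
      fix c assume c: "c \<in> set (plabels U)"
      then have "c \<in> set (plabels (PNode b Us))" using U by auto
      from PNode.prems(2)[OF this]
      show "G c = mset (map forget (concat (map h (filter (\<lambda>\<alpha>. fst \<alpha> = c) (angles U)))))"
        unfolding filter_angles_child[OF PNode.prems(1) U c] .
    qed
  qed
  moreover have "G b = mset (map forget (h (b, 0))) +
      mset (map forget (concat (map h (filter (\<lambda>\<alpha>. fst \<alpha> = b) (fangles b 0 Us)))))"
    using PNode.prems(2)[of b] by simp
  ultimately show ?case
    using forget_fgraft[OF b, of h 0]
    by (simp add: image_mset.compositionality comp_def add.assoc)
qed

lemma mset_concat_filter:
  assumes "distinct as"
  shows "mset (concat (map (\<lambda>a. filter (\<lambda>x. k x = a) xs) as)) = {#x \<in># mset xs. k x \<in> set as#}"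
  using assms
proof (induction as)
  case (Cons a as)
  have "{#x \<in># mset xs. k x \<in> set (a # as)#} =
      {#x \<in># mset xs. k x = a#} + {#x \<in># mset xs. k x \<in> set as#}"
    using Cons.prems by (induction xs) auto
  with Cons show ?case by simp
qed simp

lemma forget_pgraft_filter:
  assumes "distinct (plabels R)" "\<And>U. U \<in> set Ps \<Longrightarrow> g (proot U) \<in> set (angles R)"
  shows "forget (pgraft (\<lambda>\<alpha>. filter (\<lambda>U. g (proot U) = \<alpha>) Ps) R) =
    rgraft (\<lambda>b. {#U \<in># mset (map forget Ps). fst (g (rroot U)) = b#}) (forget R)"
proof (rule forget_pgraft[OF assms(1)])
  fix b
  let ?as = "filter (\<lambda>\<alpha>. fst \<alpha> = b) (angles R)"
  have "mset (concat (map (\<lambda>\<alpha>. filter (\<lambda>U. g (proot U) = \<alpha>) Ps) ?as)) =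
      {#U \<in># mset Ps. g (proot U) \<in> set ?as#}"
    using distinct_angles[OF assms(1)] by (intro mset_concat_filter) simp
  also have "\<dots> = {#U \<in># mset Ps. fst (g (proot U)) = b#}"
    using assms(2) by (intro filter_mset_cong) auto
  finally have "mset (map forget (concat (map (\<lambda>\<alpha>. filter (\<lambda>U. g (proot U) = \<alpha>) Ps) ?as))) =
      image_mset forget {#U \<in># mset Ps. fst (g (proot U)) = b#}"
    by simp
  then show "{#U \<in># mset (map forget Ps). fst (g (rroot U)) = b#} =
      mset (map forget (concat (map (\<lambda>\<alpha>. filter (\<lambda>U. g (proot U) = \<alpha>) Ps) ?as)))"
    by (simp add: filter_mset_image_mset comp_def)
qed

text \<open>Stated for any \<open>g\<close> with values among the angles, so that it covers the
  constant reference map as well as the increasing maps.\<close>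

lemma forget_psubst:
  assumes "distinct (plabels R)" "\<And>c. c \<in> set (pedges v P) \<Longrightarrow> g c \<in> set (angles R)"
  shows "forget (psubst v g P R) = rsubst v (fst \<circ> g) (forget P) (forget R)"
  using assms(2)
proof (induction P)
  case (PNode a Ps)
  show ?case
  proof (cases "a = v")
    case True
    then show ?thesis
      using forget_pgraft_filter[OF assms(1), of Ps g] PNode.prems by simp
  next
    case False
    have "image_mset (\<lambda>P. forget (psubst v g P R)) (mset Ps) =
        image_mset (\<lambda>P. rsubst v (fst \<circ> g) (forget P) (forget R)) (mset Ps)"
    proof (rule image_mset_cong)
      fix P assume P: "P \<in># mset Ps"
      show "forget (psubst v g P R) = rsubst v (fst \<circ> g) (forget P) (forget R)"
        by (rule PNode.IH) (use P PNode.prems False in auto)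
    qed
    with False show ?thesis
      by (simp add: image_mset.compositionality comp_def)
  qed
qed

section \<open>Cutting seen on non-planar trees\<close>

lemma image_fcuts:
  "image_mset (map_prod fst id) (mset (fcuts C b j Ys)) =
    image_mset (Pair b) {#U \<in># mset Ys. proot U \<in> C#} +
    \<Sum>\<^sub># (image_mset (\<lambda>U. image_mset (map_prod fst id) (mset (cuts C U))) {#U \<in># mset Ys. proot U \<notin> C#})"
  \<comment> \<open>Keeping only the vertex of each angle removes the dependence on
    \<open>j\<close>.\<close>
  by (induction Ys arbitrary: j) auto

text \<open>Equality of image multisets amounts to a matching of elements. It lets an induction
  hypothesis act on paired subtrees although the branches of the two trees are not listed in a
  common order.\<close>

lemma rel_mset_image_iff:
  "rel_mset (\<lambda>x y. f x = g y) M N \<longleftrightarrow> image_mset f M = image_mset g N"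
proof -
  have "rel_mset (=) (image_mset f M) (image_mset g N) \<longleftrightarrow> rel_mset (\<lambda>x y. f x = g y) M N"
    by (simp only: multiset.rel_map)
  then show ?thesis by (simp only: multiset.rel_eq)
qed

lemmas rel_mset_image = rel_mset_image_iff[THEN iffD2]
lemmas image_eq_of_rel = rel_mset_image_iff[THEN iffD1]

text \<open>At each vertex coming from \<open>T\<close>, membership in \<open>C\<close> separates
  the children in \<open>Y\<close> into grafted branches and children inherited from
  \<open>T\<close>.\<close>

lemma forget_prune_cuts:
  assumes "forget Y = rgraft G T"
    and "\<And>b U. b \<in># rlabels T \<Longrightarrow> U \<in># G b \<Longrightarrow> rroot U \<in> C"
    and "set_mset (rlabels T) \<inter> C = {}"
  shows "forget (prune C Y) = T \<and>
    image_mset (map_prod fst forget) (mset (cuts C Y)) =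
      (\<Sum>b\<in>#rlabels T. image_mset (Pair b) (G b))"
  using assms
proof (induction T arbitrary: Y)
  case (RNode b M)
  obtain Ys where Y: "Y = PNode b Ys" "image_mset forget (mset Ys) = G b + image_mset (rgraft G) M"
    using RNode.prems(1) by (cases Y) auto
  let ?N = "{#U \<in># mset Ys. proot U \<notin> C#}"
  have 1: "{#U \<in># G b. rroot U \<in> C#} = G b" "{#U \<in># G b. rroot U \<notin> C#} = {#}"
    using RNode.prems(2)[of b] by (auto simp: filter_mset_eq_conv)
  have root: "rroot U \<notin> C" if "U \<in># M" for U
  proof -
    have "rroot U \<in># rlabels (RNode b M)" using that rroot_in_rlabels[of U] by force
    then show ?thesis using RNode.prems(3) by blast
  qed
  have 2: "{#U \<in># image_mset (rgraft G) M. rroot U \<in> C#} = {#}"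
    "{#U \<in># image_mset (rgraft G) M. rroot U \<notin> C#} = image_mset (rgraft G) M"
    using root by (auto simp: filter_mset_eq_conv)
  have "image_mset forget {#U \<in># mset Ys. proot U \<in> C#} = {#U \<in># image_mset forget (mset Ys). rroot U \<in> C#}"
    "image_mset forget ?N = {#U \<in># image_mset forget (mset Ys). rroot U \<notin> C#}"
    by (simp_all add: filter_mset_image_mset comp_def)
  then have 3: "image_mset forget {#U \<in># mset Ys. proot U \<in> C#} = G b"
    "image_mset forget ?N = image_mset (rgraft G) M"
    by (simp_all add: Y(2) 1 2)
  \<comment> \<open>The kept children of \<open>Y\<close> are paired with the branches of
    \<open>T\<close> they come from, and the induction hypothesis is applied to each pair.\<close>
  have rel: "rel_mset (\<lambda>Y' T'. forget (prune C Y') = T' \<and>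
      image_mset (map_prod fst forget) (mset (cuts C Y')) = (\<Sum>b\<in>#rlabels T'. image_mset (Pair b) (G b))) ?N M"
  proof (rule multiset.rel_mono_strong[OF rel_mset_image[OF 3(2)]])
    fix Y' T' assume T': "T' \<in># M" and "forget Y' = rgraft G T'"
    then show "forget (prune C Y') = T' \<and>
      image_mset (map_prod fst forget) (mset (cuts C Y')) = (\<Sum>b\<in>#rlabels T'. image_mset (Pair b) (G b))"
    proof (intro RNode.IH[OF T'])
      show "rroot U \<in> C" if "c \<in># rlabels T'" "U \<in># G c" for c U
        using that T' by (intro RNode.prems(2)[of c]) auto
      show "set_mset (rlabels T') \<inter> C = {}" using T' RNode.prems(3) by auto
    qed
  qed
  have "image_mset (\<lambda>Y'. forget (prune C Y')) ?N = image_mset (\<lambda>T. T) M"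
    by (rule image_eq_of_rel, rule multiset.rel_mono_strong[OF rel]) simp
  then have "forget (prune C Y) = RNode b M"
    by (simp add: Y image_mset.compositionality comp_def)
  moreover have "image_mset (\<lambda>Y'. image_mset (map_prod fst forget) (mset (cuts C Y'))) ?N =
      image_mset (\<lambda>T'. \<Sum>b\<in>#rlabels T'. image_mset (Pair b) (G b)) M"
    by (rule image_eq_of_rel, rule multiset.rel_mono_strong[OF rel]) simp
  moreover have "image_mset (map_prod fst forget) (mset (cuts C Y)) =
      image_mset (Pair b) (image_mset forget {#U \<in># mset Ys. proot U \<in> C#}) +
      \<Sum>\<^sub># (image_mset (\<lambda>Y'. image_mset (map_prod fst forget) (mset (cuts C Y'))) ?N)"
  proof -
    have c1: "image_mset (map_prod fst forget) N = image_mset (map_prod id forget) (image_mset (map_prod fst id) N)"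
      for N :: "(('a \<times> nat) \<times> 'a ptree) multiset"
      by (simp add: image_mset.compositionality map_prod.comp)
    have c2: "image_mset f (\<Sum>\<^sub># (image_mset g N)) = \<Sum>\<^sub># (image_mset (\<lambda>x. image_mset f (g x)) N)"
      for f :: "'a \<times> 'a ptree \<Rightarrow> 'a \<times> 'a rtree" and g and N :: "'a ptree multiset"
      by (induction N) auto
    have c3: "image_mset (map_prod id forget) (image_mset (Pair b) N) = image_mset (Pair b) (image_mset forget N)"
      for N :: "'a ptree multiset"
      by (simp add: image_mset.compositionality comp_def)
    show ?thesis
      by (simp only: Y cuts.simps c1 image_fcuts image_mset_union c2 c3)
  qed
  moreover have "(\<Sum>b\<in>#\<Sum>\<^sub># (image_mset rlabels M). image_mset (Pair b) (G b)) =
      \<Sum>\<^sub># (image_mset (\<lambda>T'. \<Sum>b\<in>#rlabels T'. image_mset (Pair b) (G b)) M)"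
    by (induction M) auto
  ultimately show ?case by (simp add: 3)
qed

text \<open>The list \<open>Ps\<close> is left free because the order of the branches at \<open>v\<close> is only known once \<open>Y\<close> has
  been cut.\<close>

lemma planar_rep_rsubst:
  assumes "forget Q = rsubst v f S T" "nodup (rlabels S)" "v \<in># rlabels S"
  shows "\<exists>Y. forget Y = rgraft (\<lambda>b. {#U \<in># rbranches v S. f (rroot U) = b#}) T \<and>
    (\<forall>Ps. mset (map forget Ps) = rbranches v S \<longrightarrow>
      (\<exists>P. forget P = S \<and> pbranches v P = Ps \<and> preplace v Y P = Q))"
  using assms
proof (induction S arbitrary: Q)
  case (RNode a M)
  show ?case
  proof (cases "v = a")
    case True
    \<comment> \<open>At \<open>v\<close> itself \<open>Y\<close> is all of \<open>Q\<close>, and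
      every admissible list \<open>Ps\<close> may serve as the branches of \<open>P\<close>.\<close>
    show ?thesis
    proof (rule exI[of _ Q], intro conjI allI impI)
      show "forget Q = rgraft (\<lambda>b. {#U \<in># rbranches v (RNode a M). f (rroot U) = b#}) T"
        using RNode.prems(1) True by simp
      show "\<exists>P. forget P = RNode a M \<and> pbranches v P = Ps \<and> preplace v Q P = Q"
        if "mset (map forget Ps) = rbranches v (RNode a M)" for Ps
        using that True by (intro exI[of _ "PNode v Ps"]) simp
    qed
  next
    case False
    obtain S M' where S: "M = add_mset S M'" "v \<in># rlabels S" "nodup (rlabels S)"
      "v \<notin># \<Sum>\<^sub># (image_mset rlabels M')"
      using split_rbranch[OF RNode.prems(2,3) False] .
    have rb: "rbranches v (RNode a M) = rbranches v S"
      using False S by (simp add: image_rbranches_notin)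
    have "forget Q = RNode a (add_mset (rsubst v f S T) M')"
      using RNode.prems(1) False S by (simp add: image_rbranches_notin)
    then obtain Qs where Q: "Q = PNode a Qs" "mset (map forget Qs) = add_mset (rsubst v f S T) M'"
      by (cases Q) auto
    from Q(2) obtain us Q' ws where Qs: "Qs = us @ Q' # ws" "forget Q' = rsubst v f S T"
      "mset (map forget (us @ ws)) = M'"
      by (rule mset_map_eq_add_msetE)
    have "S \<in># M" using S by simp
    from RNode.IH[OF this Qs(2) S(3,2)] obtain Y where
      Y: "forget Y = rgraft (\<lambda>b. {#U \<in># rbranches v S. f (rroot U) = b#}) T"
      and ex: "\<And>Ps. mset (map forget Ps) = rbranches v S \<Longrightarrow>
        (\<exists>P. forget P = S \<and> pbranches v P = Ps \<and> preplace v Y P = Q')"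
      by blast
    have notin: "v \<notin> set (plabels X)" if "X \<in> set us \<union> set ws" for X
    proof -
      have "forget X \<in># M'" using that Qs(3) by auto
      then have "v \<notin># rlabels (forget X)" using S(4) by auto
      then show ?thesis by (simp add: rlabels_forget)
    qed
    have id: "map (preplace v Y) us = us" "map (preplace v Y) ws = ws"
      using notin by (auto intro!: map_idI simp: preplace_notin)
    have "\<exists>P. forget P = RNode a M \<and> pbranches v P = Ps \<and> preplace v Y P = Q"
      if Ps: "mset (map forget Ps) = rbranches v (RNode a M)" for Ps
    proof -
      from ex[of Ps] Ps obtain P where P: "forget P = S" "pbranches v P = Ps" "preplace v Y P = Q'"
        unfolding rb by blast
      have "forget (PNode a (us @ P # ws)) = RNode a M"
        using P Qs(3) S(1) by simp
      moreover have "pbranches v (PNode a (us @ P # ws)) = Ps"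
        using False P notin by (simp add: concat_pbranches_notin)
      moreover have "preplace v Y (PNode a (us @ P # ws)) = Q"
        using False P id Q(1) Qs(1) by simp
      ultimately show ?thesis by blast
    qed
    with Y show ?thesis unfolding rb by blast
  qed
qed

section \<open>Labels of grafted and substituted trees\<close>

lemma rlabels_rgraft:
  "rlabels (rgraft G T) = rlabels T + (\<Sum>b\<in>#rlabels T. \<Sum>\<^sub># (image_mset rlabels (G b)))"
proof (induction T)
  case (RNode b M)
  let ?F = "\<lambda>b. \<Sum>\<^sub># (image_mset rlabels (G b))"
  have "\<Sum>\<^sub># (image_mset (\<lambda>T. rlabels (rgraft G T)) M) =
      \<Sum>\<^sub># (image_mset rlabels M) + (\<Sum>b\<in>#\<Sum>\<^sub># (image_mset rlabels M). ?F b)"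
    using RNode by (induction M) auto
  then show ?case by (simp add: image_mset.compositionality comp_def)
qed

text \<open>Each \<open>U\<close> lies in exactly one fibre, because \<open>k U\<close> occurs
  exactly once in \<open>N\<close>.\<close>

lemma sum_filter_fibres:
  assumes "nodup N" "\<And>U. U \<in># M \<Longrightarrow> k U \<in># N"
  shows "(\<Sum>b\<in>#N. {#U \<in># M. k U = b#}) = M"
  using assms(2)
proof (induction M)
  case empty
  show ?case by (induction N) auto
next
  case (add U M)
  have "k U \<in># N" using add.prems by simp
  have "(\<Sum>b\<in>#N. {#U \<in># add_mset U M. k U = b#}) =
      (\<Sum>b\<in>#N. if k U = b then {#U#} else {#}) + (\<Sum>b\<in>#N. {#U \<in># M. k U = b#})"
    by (induction N) auto
  moreover obtain N' where N: "N = add_mset (k U) N'" "k U \<notin># N'"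
    using \<open>k U \<in># N\<close> assms(1) by (metis multi_member_split nodup_add_mset)
  have "(\<Sum>b\<in>#N. if k U = b then {#U#} else {#}) = {#U#}"
  proof -
    have "image_mset (\<lambda>b. if k U = b then {#U#} else {#}) N' = image_mset (\<lambda>_. {#}) N'"
      using N(2) by (intro image_mset_cong) auto
    then show ?thesis by (simp add: N(1))
  qed
  ultimately show ?case using add by simp
qed

lemma rlabels_rgraft_filter:
  assumes "nodup (rlabels T)" "\<And>U. U \<in># M \<Longrightarrow> f (rroot U) \<in># rlabels T"
  shows "rlabels (rgraft (\<lambda>b. {#U \<in># M. f (rroot U) = b#}) T) =
    rlabels T + \<Sum>\<^sub># (image_mset rlabels M)"
proof -
  have "(\<Sum>b\<in>#N. \<Sum>\<^sub># (image_mset rlabels (G b))) = \<Sum>\<^sub># (image_mset rlabels (\<Sum>b\<in>#N. G b))"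
    for N :: "'a multiset" and G :: "'a \<Rightarrow> 'a rtree multiset"
    by (induction N) auto
  then show ?thesis
    by (simp add: rlabels_rgraft sum_filter_fibres[of "rlabels T" M "\<lambda>U. f (rroot U)", OF assms])
qed

text \<open>One occurrence of \<open>v\<close> is consumed; adding it on the left avoids a
  subtraction of multisets.\<close>

lemma rlabels_rsubst:
  assumes "nodup (rlabels S)" "v \<in># rlabels S" "nodup (rlabels T)"
    and "\<And>c. c \<in># redges v S \<Longrightarrow> f c \<in># rlabels T"
  shows "add_mset v (rlabels (rsubst v f S T)) = rlabels S + rlabels T"
  using assms(1,2,4)
proof (induction S)
  case (RNode a M)
  show ?case
  proof (cases "v = a")
    case True
    then show ?thesis
      using RNode.prems(3) rlabels_rgraft_filter[OF assms(3), of M f] by auto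
  next
    case False
    obtain S M' where S: "M = add_mset S M'" "v \<in># rlabels S" "nodup (rlabels S)"
      "v \<notin># \<Sum>\<^sub># (image_mset rlabels M')"
      using split_rbranch[OF RNode.prems(1,2) False] .
    have "add_mset v (rlabels (rsubst v f S T)) = rlabels S + rlabels T"
      using S False RNode.prems(3) by (intro RNode.IH) auto
    with S False show ?thesis
      by (simp add: image_rbranches_notin add_mset_commute[of v a] flip: union_mset_add_mset_left)
  qed
qed


section \<open>Symmetrization of a composite\<close>

lemma mset_pedges: "mset (pedges v P) = redges v (forget P)"
proof -
  have "mset (map proot (pbranches v P)) = image_mset rroot (mset (map forget (pbranches v P)))"
    by (simp add: image_mset.compositionality comp_def)
  then show ?thesis unfolding pedges_eq redges_eq forget_pbranches .
qed

lemma set_pedges: "forget P = S \<Longrightarrow> set (pedges v P) = set_mset (redges v S)"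
  using mset_pedges[of v P] by (metis set_mset_mset)

lemma set_plabels: "forget P = S \<Longrightarrow> set (plabels P) = set_mset (rlabels S)"
  using rlabels_forget[of P] by (metis set_mset_mset)

lemma distinct_plabels: "forget P = S \<Longrightarrow> nodup (rlabels S) \<Longrightarrow> distinct (plabels P)"
  using rlabels_forget[of P] by simp

text \<open>Keeps the roots of the branches at \<open>v\<close> apart from the vertices of
  \<open>T\<close>, so that they can serve as the cutting set \<open>C\<close>; \<open>v\<close> has
  to be excluded because \<open>T\<close> may contain that label.\<close>

lemma redges_disjoint:
  assumes "nodup (rlabels S)"
  shows "set_mset (redges v S) \<subseteq> set_mset (rlabels S) - {v}"
proof
  fix c assume "c \<in># redges v S"
  then obtain U where U: "U \<in># rbranches v S" "c = rroot U" by (auto simp: redges_eq)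
  then have "c \<in># rlabels S"
    using rlabels_rbranches[OF U(1)] rroot_in_rlabels[of U] by blast
  moreover have "c \<noteq> v"
    using notin_rbranches[OF assms U(1)] rroot_in_rlabels[of U] U(2) by auto
  ultimately show "c \<in> set_mset (rlabels S) - {v}" by simp
qed

text \<open>The blocks met by the scan are the fibres of \<open>g\<close> over the angles; as
  \<open>g\<close> is increasing, their concatenation is the list of branches itself.\<close>

lemma cut_graft_increasing:
  assumes "distinct (plabels R)" "set (plabels R) \<inter> set (pedges v P) = {}"
    and "g \<in> increasing_maps v P R"
  defines "Y \<equiv> pgraft (\<lambda>\<alpha>. filter (\<lambda>U. g (proot U) = \<alpha>) (pbranches v P)) R"
  shows "prune (set (pedges v P)) Y = R"
    and "cuts (set (pedges v P)) Y = map (\<lambda>U. (g (proot U), U)) (pbranches v P)"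
proof -
  let ?C = "set (pedges v P)" and ?Ps = "pbranches v P"
  have roots: "proot U \<in> ?C" if "U \<in> set (filter (\<lambda>U. g (proot U) = \<alpha>) ?Ps)" for U \<alpha>
    using that by (auto simp: pedges_eq)
  show "prune ?C Y = R"
    unfolding Y_def using roots assms(2) by (rule prune_pgraft)
  have g: "g \<in> ?C \<rightarrow>\<^sub>E set (angles R)" "sorted_wrt (precedes (angles R)) (map g (pedges v P))"
    using assms(3) by (simp_all add: increasing_maps_def angle_le_eq)
  have "concat (map (\<lambda>\<alpha>. filter (\<lambda>U. g (proot U) = \<alpha>) ?Ps) (angles R)) = ?Ps"
  proof (rule concat_filter_sorted)
    show "(\<lambda>U. g (proot U)) ` set ?Ps \<subseteq> set (angles R)"
      using g(1) by (auto simp: pedges_eq)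
    show "sorted_wrt (precedes (angles R)) (map (\<lambda>U. g (proot U)) ?Ps)"
      using g(2) by (simp add: pedges_eq comp_def)
  qed (rule distinct_angles[OF assms(1)])
  moreover have "cuts ?C Y =
      concat (map (\<lambda>\<alpha>. map (Pair \<alpha>) (filter (\<lambda>U. g (proot U) = \<alpha>) ?Ps)) (angles R))"
    unfolding Y_def using roots assms(2) by (rule cuts_pgraft)
  moreover have "map (Pair \<alpha>) (filter (\<lambda>U. g (proot U) = \<alpha>) ?Ps) =
      map (\<lambda>U. (g (proot U), U)) (filter (\<lambda>U. g (proot U) = \<alpha>) ?Ps)" for \<alpha>
    by (rule map_cong) auto
  moreover have "concat (map (\<lambda>\<alpha>. map f (h \<alpha>)) as) = map f (concat (map h as))"
    for f :: "'a ptree \<Rightarrow> ('a \<times> nat) \<times> 'a ptree" and h and as :: "('a \<times> nat) list"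
    by (simp add: map_concat comp_def)
  ultimately show "cuts ?C Y = map (\<lambda>U. (g (proot U), U)) ?Ps"
    by (simp only:)
qed

text \<open>The root label of \<open>T\<close> and the children of \<open>v\<close> depend on
  \<open>S\<close> and \<open>T\<close> alone, so the same search and the same cut apply to both
  composites.\<close>

lemma psubst_inj:
  assumes S: "nodup (rlabels S)" "v \<in># rlabels S" and T: "nodup (rlabels T)"
    and disj: "(set_mset (rlabels S) - {v}) \<inter> set_mset (rlabels T) = {}"
    and P: "forget P = S" "forget P' = S" and R: "forget R = T" "forget R' = T"
    and g: "g \<in> increasing_maps v P R" "g' \<in> increasing_maps v P' R'"
    and eq: "psubst v g P R = psubst v g' P' R'"
  shows "P = P' \<and> R = R' \<and> g = g'"
proof -
  let ?Y = "\<lambda>P R g. pgraft (\<lambda>\<alpha>. filter (\<lambda>U. g (proot U) = \<alpha>) (pbranches v P)) R"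
  let ?C = "set_mset (redges v S)" and ?r = "rroot T"
  have *: "?Y P R g = PNode ?r (pbranches ?r (psubst v g P R))"
    "preplace ?r (PNode v (pbranches v P)) (psubst v g P R) = P"
    "prune ?C (?Y P R g) = R"
    "cuts ?C (?Y P R g) = map (\<lambda>U. (g (proot U), U)) (pbranches v P)"
    if "forget P = S" "forget R = T" "g \<in> increasing_maps v P R" for P R g
  proof -
    have d: "distinct (plabels P)" "distinct (plabels R)" "v \<in> set (plabels P)"
      using distinct_plabels[OF that(1) S(1)] distinct_plabels[OF that(2) T] set_plabels[OF that(1)] S(2)
      by simp_all
    have r: "?r \<notin> set (plabels P) - {v}"
      using disj set_plabels[OF that(1)] rroot_in_rlabels[of T] by blast
    have C: "set (plabels R) \<inter> set (pedges v P) = {}"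
      using set_plabels[OF that(2)] set_pedges[OF that(1)] redges_disjoint[OF S(1)] disj by blast
    show "prune ?C (?Y P R g) = R"
      "cuts ?C (?Y P R g) = map (\<lambda>U. (g (proot U), U)) (pbranches v P)"
      using cut_graft_increasing[OF d(2) C that(3)] by (simp_all only: set_pedges[OF that(1)])
    have root: "proot (?Y P R g) = ?r" using that(2) by auto
    have subst: "psubst v g P R = preplace v (?Y P R g) P"
      by (rule psubst_eq_preplace[OF d(1,3)])
    have "pbranches ?r (psubst v g P R) = pbranches ?r (?Y P R g)"
      unfolding subst by (rule pbranches_preplace[OF d(1,3) r root])
    moreover have "Y = PNode ?r (pbranches ?r Y)" if "proot Y = ?r" for Y
      using that by (cases Y) simp
    ultimately show "?Y P R g = PNode ?r (pbranches ?r (psubst v g P R))"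
      using root by simp
    show "preplace ?r (PNode v (pbranches v P)) (psubst v g P R) = P"
      unfolding subst preplace_preplace[OF r root] by (rule preplace_pbranches[OF d(1)])
  qed
  note 1 = *[OF P(1) R(1) g(1)] and 2 = *[OF P(2) R(2) g(2)]
  have Y: "?Y P R g = ?Y P' R' g'"
    unfolding 1(1) 2(1) eq ..
  have R': "R = R'" using 1(3) 2(3) unfolding Y by simp
  have maps: "map (\<lambda>U. (g (proot U), U)) (pbranches v P) = map (\<lambda>U. (g' (proot U), U)) (pbranches v P')"
    using 1(4) 2(4) unfolding Y by simp
  from arg_cong[OF this, of "map snd"] have Ps: "pbranches v P = pbranches v P'"
    by (simp add: comp_def)
  with maps have "\<forall>c\<in>?C. g c = g' c"
    unfolding set_pedges[OF P(1), symmetric] pedges_eq by simp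
  \<comment> \<open>The cuts determine the maps on the edges; elsewhere both are
    \<open>undefined\<close>, as elements of extensional function spaces.\<close>
  moreover have "g \<in> extensional ?C" "g' \<in> extensional ?C"
    using g set_pedges[OF P(1), of v] set_pedges[OF P(2), of v]
    by (auto simp: increasing_maps_def PiE_def)
  ultimately have "g = g'" by (intro extensionalityI) auto
  moreover have "P = P'"
    using 1(2) unfolding Ps eq 2(2) by (rule sym)
  ultimately show ?thesis using R' by blast
qed

lemma psubst_surj:
  assumes S: "nodup (rlabels S)" "v \<in># rlabels S" and T: "nodup (rlabels T)"
    and disj: "(set_mset (rlabels S) - {v}) \<inter> set_mset (rlabels T) = {}"
    and f: "f \<in> set_mset (redges v S) \<rightarrow>\<^sub>E set_mset (rlabels T)"
    and Q: "forget Q = rsubst v f S T"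
  obtains P R g where "forget P = S" "forget R = T" "g \<in> increasing_maps v P R"
    "restrict (fst \<circ> g) (set_mset (redges v S)) = f" "psubst v g P R = Q"
proof -
  let ?C = "set_mset (redges v S)" and ?M = "rbranches v S"
  let ?G = "\<lambda>b. {#U \<in># ?M. f (rroot U) = b#}"
  obtain Y where Y: "forget Y = rgraft ?G T"
    and ex: "\<And>Ps. mset (map forget Ps) = ?M \<Longrightarrow> \<exists>P. forget P = S \<and> pbranches v P = Ps \<and> preplace v Y P = Q"
    using planar_rep_rsubst[OF Q S] by blast
  have fM: "f (rroot U) \<in># rlabels T" if "U \<in># ?M" for U
    using f that by (auto simp: redges_eq PiE_def Pi_def)
  have C: "set_mset (rlabels T) \<inter> ?C = {}"
    using redges_disjoint[OF S(1)] disj by blast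
  have "rroot U \<in> ?C" if "U \<in># ?G b" for b U
    using that by (auto simp: redges_eq)
  from forget_prune_cuts[OF Y this C] have
    R: "forget (prune ?C Y) = T" and
    cuts: "image_mset (map_prod fst forget) (mset (cuts ?C Y)) = (\<Sum>b\<in>#rlabels T. image_mset (Pair b) (?G b))"
    by simp_all
  define R where "R = prune ?C Y"
  define pl where "pl = cuts ?C Y"
  define Ps where "Ps = map snd pl"
  \<comment> \<open>Prepares the distinctness of the labels of \<open>Y\<close>: the branches at
    \<open>v\<close> avoid \<open>v\<close>, hence also every label of \<open>T\<close>.\<close>
  have "set_mset (\<Sum>\<^sub># (image_mset rlabels ?M)) \<subseteq> set_mset (rlabels S) - {v}"
    using rlabels_rbranches[of _ v S] notin_rbranches[OF S(1), of _ v] by fastforce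
  then have "nodup (rlabels (rgraft ?G T))"
    using T nodup_rbranches[OF S(1), of v] disj
    by (auto simp: rlabels_rgraft_filter[of T ?M f, OF T fM] nodup_add)
  then have dY: "distinct (plabels Y)" by (rule distinct_plabels[OF Y])
  have graft: "pgraft (select pl) R = Y"
    unfolding pl_def R_def by (rule pgraft_cuts[OF dY])
  have dR: "distinct (plabels R)" unfolding R_def by (rule distinct_plabels_prune[OF dY])
  have "image_mset snd (\<Sum>b\<in>#N. image_mset (Pair b) (?G b)) = (\<Sum>b\<in>#N. ?G b)" for N
    by (induction N) (auto simp: image_mset.compositionality comp_def)
  then have "image_mset snd (image_mset (map_prod fst forget) (mset pl)) = ?M"
    unfolding pl_def cuts by (simp add: sum_filter_fibres[of "rlabels T" ?M "\<lambda>U. f (rroot U)", OF T fM])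
  then have Ps: "mset (map forget Ps) = ?M"
    by (simp add: Ps_def image_mset.compositionality comp_def)
  from ex[OF Ps] obtain P where P: "forget P = S" "pbranches v P = Ps" "preplace v Y P = Q"
    by blast
  have edges: "pedges v P = map proot Ps" "set (pedges v P) = ?C"
    using P(2) by (simp add: pedges_eq) (rule set_pedges[OF P(1)])
  have dist: "distinct (map proot Ps)"
    using nodup_redges[OF S(1), of v] mset_pedges[of v P] edges(1) P(1) by (metis nodup_mset)
  \<comment> \<open>The angle of the cut whose branch has root \<open>c\<close>; this cut is unique
    because the children of \<open>v\<close> have distinct labels.\<close>
  define g where "g = restrict (\<lambda>c. fst (the_elem {x \<in> set pl. proot (snd x) = c})) ?C"
  have g: "g (proot (snd x)) = fst x" if "x \<in> set pl" for x
  proof -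
    have "{y \<in> set pl. proot (snd y) = proot (snd x)} = {x}"
    proof (intro set_eqI iffI)
      fix y assume y: "y \<in> {y \<in> set pl. proot (snd y) = proot (snd x)}"
      have "inj_on (\<lambda>x. proot (snd x)) (set pl)"
        using dist by (simp add: Ps_def comp_def distinct_map)
      with y that show "y \<in> {x}" by (auto dest: inj_onD)
    qed (use that in simp)
    moreover have "proot (snd x) \<in> ?C"
      using that unfolding edges(2)[symmetric] edges(1) Ps_def by simp
    ultimately show ?thesis by (simp add: g_def)
  qed
  have sel: "filter (\<lambda>U. g (proot U) = \<alpha>) Ps = select pl \<alpha>" for \<alpha>
  proof -
    have "filter (\<lambda>x. g (proot (snd x)) = \<alpha>) pl = filter (\<lambda>x. fst x = \<alpha>) pl"
      using g by (intro filter_cong) auto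
    then show ?thesis by (simp add: Ps_def select_def filter_map comp_def)
  qed
  have "set (plabels R) \<inter> ?C = {}"
    using C set_plabels[OF R] by (simp add: R_def)
  moreover have "proot U \<in> ?C" if "U \<in> set (select pl \<alpha>)" for U \<alpha>
    using that unfolding edges(2)[symmetric] edges(1) sel[symmetric] by simp
  \<comment> \<open>\<open>Y\<close> is the graft of its own cuts onto \<open>R\<close>, so cutting
    it lists the blocks in the order of the angles. This makes \<open>g\<close> increasing.\<close>
  ultimately have blocks: "pl = concat (map (\<lambda>\<alpha>. map (Pair \<alpha>) (select pl \<alpha>)) (angles R))"
    using cuts_pgraft[of "select pl" ?C R] graft by (simp add: pl_def)
  have keys: "map g (map proot Ps) = map fst pl"
    using g by (simp add: Ps_def)
  have "fst ` set pl \<subseteq> set (angles R)"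
    by (subst blocks) auto
  moreover have "g ` ?C = fst ` set pl"
    using arg_cong[OF keys, of set] unfolding edges(2)[symmetric] edges(1) by (simp add: image_image)
  ultimately have "g ` ?C \<subseteq> set (angles R)" by simp
  then have "g \<in> ?C \<rightarrow>\<^sub>E set (angles R)" by (auto simp: g_def)
  moreover have "sorted_wrt (precedes (angles R)) (map g (pedges v P))"
    unfolding edges(1) keys by (subst blocks) (rule sorted_concat_blocks)
  ultimately have incr: "g \<in> increasing_maps v P R"
    unfolding increasing_maps_def angle_le_eq edges(2) by simp
  have "restrict (fst \<circ> g) ?C = f"
  proof (rule extensionalityI)
    fix c assume c: "c \<in> ?C"
    then obtain x where x: "x \<in> set pl" "c = proot (snd x)"
      unfolding edges(2)[symmetric] edges(1) Ps_def by auto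
    \<comment> \<open>After forgetting, the multiset of cuts is known explicitly and places each
      branch \<open>U\<close> at the vertex \<open>f (rroot U)\<close>.\<close>
    have "(fst (fst x), forget (snd x)) \<in># image_mset (map_prod fst forget) (mset pl)"
      using x(1) by (auto simp: map_prod_def case_prod_unfold intro!: image_eqI[of _ _ x])
    then have "f (rroot (forget (snd x))) = fst (fst x)"
      unfolding pl_def cuts by auto
    with g[OF x(1)] x(2) c show "restrict (fst \<circ> g) ?C c = f c" by simp
  qed (use f in \<open>auto simp: PiE_def\<close>)
  moreover have "psubst v g P R = Q"
    using psubst_eq_preplace[OF distinct_plabels[OF P(1) S(1)], of v g R] S(2) set_plabels[OF P(1)]
      graft P(2,3) sel by (simp add: fun_eq_iff)
  ultimately show thesis
    using that[OF P(1) R[folded R_def] incr] by blast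
qed

text \<open>The restriction makes the vertex map an element of the extensional function space, as
  \<open>fst \<circ> g\<close> need not be \<open>undefined\<close> off the edges.\<close>

lemma bij_betw_psubst:
  assumes S: "nodup (rlabels S)" "v \<in># rlabels S" and T: "nodup (rlabels T)"
    and disj: "(set_mset (rlabels S) - {v}) \<inter> set_mset (rlabels T) = {}"
  shows "bij_betw (\<lambda>(P, R, g). (restrict (fst \<circ> g) (set_mset (redges v S)), psubst v g P R))
    (SIGMA P:planar_reps S. SIGMA R:planar_reps T. increasing_maps v P R)
    (SIGMA f:set_mset (redges v S) \<rightarrow>\<^sub>E set_mset (rlabels T). planar_reps (rsubst v f S T))"
    (is "bij_betw ?F ?D1 ?D2")
proof (rule bij_betw_imageI)
  show "inj_on ?F ?D1"
  proof (rule inj_onI)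
    fix x y assume "x \<in> ?D1" "y \<in> ?D1" and eq: "?F x = ?F y"
    then obtain P R g P' R' g' where xy: "x = (P, R, g)" "y = (P', R', g')"
      and *: "forget P = S" "forget R = T" "g \<in> increasing_maps v P R"
      "forget P' = S" "forget R' = T" "g' \<in> increasing_maps v P' R'"
      by (auto simp: planar_reps_def)
    have "psubst v g P R = psubst v g' P' R'" using eq by (simp add: xy)
    from psubst_inj[OF S T disj *(1,4,2,5,3,6) this] show "x = y" by (simp add: xy)
  qed
  show "?F ` ?D1 = ?D2"
  proof (intro subset_antisym subsetI)
    fix z assume "z \<in> ?F ` ?D1"
    then obtain P R g where z: "z = ?F (P, R, g)"
      and *: "forget P = S" "forget R = T" "g \<in> increasing_maps v P R"
      by (auto simp: planar_reps_def)
    have g: "g c \<in> set (angles R)" if "c \<in> set (pedges v P)" for c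
      using *(3) that by (auto simp: increasing_maps_def)
    have "fst (g c) \<in># rlabels T" if "c \<in># redges v S" for c
    proof -
      have "fst (g c) \<in> fst ` set (angles R)"
        using g[of c] that set_pedges[OF *(1)] by simp
      then show ?thesis unfolding fst_angles set_plabels[OF *(2)] .
    qed
    moreover have "forget (psubst v g P R) = rsubst v (fst \<circ> g) S T"
      using forget_psubst[OF distinct_plabels[OF *(2) T] g] * by simp
    moreover have "rsubst v (fst \<circ> g) S T = rsubst v (restrict (fst \<circ> g) (set_mset (redges v S))) S T"
      by (rule rsubst_cong) simp
    ultimately show "z \<in> ?D2" by (simp add: z planar_reps_def)
  next
    fix z assume z: "z \<in> ?D2"
    then obtain f Q where fQ: "z = (f, Q)" "f \<in> set_mset (redges v S) \<rightarrow>\<^sub>E set_mset (rlabels T)"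
      "forget Q = rsubst v f S T"
      by (auto simp: planar_reps_def)
    obtain P R g where "forget P = S" "forget R = T" "g \<in> increasing_maps v P R"
      "restrict (fst \<circ> g) (set_mset (redges v S)) = f" "psubst v g P R = Q"
      using psubst_surj[OF S T disj fQ(2,3)] .
    then show "z \<in> ?F ` ?D1"
      by (intro image_eqI[of _ _ "(P, R, g)"]) (simp_all add: fQ(1) planar_reps_def)
  qed
qed

section \<open>Energy, weight and labels of composites\<close>

lemma rheights_forget: "rheights (forget P) = mset (pheights P)"
proof (induction P)
  case (PNode a Ps)
  have "{#rheights (forget P). P \<in># mset Ps#} = {#mset (pheights P). P \<in># mset Ps#}"
    by (rule image_mset_cong) (simp add: PNode)
  then show ?case
    by (simp add: mset_concat image_mset.compositionality comp_def flip: sum_mset_sum_list)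
qed

lemma penergy_eq: "penergy W P = renergy W (forget P)"
  by (simp add: penergy_def renergy_def rheights_forget flip: sum_mset_sum_list)

lemma pweight_eq: "pweight W P = rweight W (forget P)"
  by (simp add: pweight_def rweight_def rlabels_forget flip: sum_mset_sum_list)

lemma nodup_rlabels_rsubst:
  assumes S: "nodup (rlabels S)" "v \<in># rlabels S" and T: "nodup (rlabels T)"
    and disj: "(set_mset (rlabels S) - {v}) \<inter> set_mset (rlabels T) = {}"
    and f: "\<And>c. c \<in># redges v S \<Longrightarrow> f c \<in># rlabels T"
  shows "nodup (rlabels (rsubst v f S T))"
    and "set_mset (rlabels (rsubst v f S T)) = set_mset (rlabels S) - {v} \<union> set_mset (rlabels T)"
proof -
  obtain N where N: "rlabels S = add_mset v N" using S(2) by (meson multi_member_split)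
  have "add_mset v (rlabels (rsubst v f S T)) = add_mset v (N + rlabels T)"
    using rlabels_rsubst[OF S T f] by (simp add: N)
  then have eq: "rlabels (rsubst v f S T) = N + rlabels T" by simp
  have v: "v \<notin># N" "nodup N" using S(1) by (simp_all add: N nodup_add_mset)
  with T disj show "nodup (rlabels (rsubst v f S T))"
    by (auto simp: eq N nodup_add)
  show "set_mset (rlabels (rsubst v f S T)) = set_mset (rlabels S) - {v} \<union> set_mset (rlabels T)"
    using v by (auto simp: eq N)
qed

lemma finite_increasing_maps: "finite (increasing_maps v P R)"
  unfolding increasing_maps_def
  by (rule finite_subset[of _ "set (pedges v P) \<rightarrow>\<^sub>E set (angles R)"]) (auto intro: finite_PiE)

lemma sym_tree_rcomp:
  fixes lam :: "'k::comm_ring_1"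
  assumes S: "nodup (rlabels S)" "v \<in># rlabels S" and T: "nodup (rlabels T)"
    and disj: "(set_mset (rlabels S) - {v}) \<inter> set_mset (rlabels T) = {}"
  shows "lin_ext sym_tree (rcomp lam W X v S T) =
    bilin_ext (pcomp_tree lam W X v) (sym_tree S) (sym_tree T)"
proof -
  have bilin: "bilin_ext (pcomp_tree lam W X v) (sym_tree S) (sym_tree T) =
      (\<Sum>P\<in>planar_reps S. \<Sum>R\<in>planar_reps T. pcomp_tree lam W X v P R)"
    by (simp add: sym_tree_eq S T bilin_ext_def lin_ext_sum)
  show ?thesis
  proof (cases "rweight X T = W v")
    case False
    then have "pcomp_tree lam W X v P R = 0" if "R \<in> planar_reps T" for P R
      using that by (simp add: pcomp_tree_def pweight_eq planar_reps_def)
    with False show ?thesis by (simp add: bilin rcomp_def)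
  next
    case True
    let ?d = "renergy (weight_join (set_mset (rlabels T)) W X)"
    let ?E = "set_mset (redges v S)" and ?B = "set_mset (rlabels T)"
    \<comment> \<open>The coefficient is a function of \<open>f\<close> alone, so all planar
      representations of one composite share it.\<close>
    define c where "c f = lam ^ (?d (rsubst v f S T) - ?d (rsubst v (\<lambda>_. rroot T) S T))" for f
    have "lin_ext sym_tree (rcomp lam W X v S T) =
        (\<Sum>f\<in>?E \<rightarrow>\<^sub>E ?B. scale (c f) (sym_tree (rsubst v f S T)))"
      using True by (simp add: rcomp_def lin_ext_sum c_def Let_def)
    also have "\<dots> = (\<Sum>f\<in>?E \<rightarrow>\<^sub>E ?B. \<Sum>Q\<in>planar_reps (rsubst v f S T). Poly_Mapping.single Q (c f))"
    proof (rule sum.cong[OF refl])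
      fix f assume "f \<in> ?E \<rightarrow>\<^sub>E ?B"
      then have "nodup (rlabels (rsubst v f S T))"
        by (intro nodup_rlabels_rsubst[OF S T disj]) auto
      then show "scale (c f) (sym_tree (rsubst v f S T)) =
          (\<Sum>Q\<in>planar_reps (rsubst v f S T). Poly_Mapping.single Q (c f))"
        by (simp add: sym_tree_eq scale_sum)
    qed
    also have "\<dots> = (\<Sum>(f, Q)\<in>(SIGMA f:?E \<rightarrow>\<^sub>E ?B. planar_reps (rsubst v f S T)). Poly_Mapping.single Q (c f))"
      by (simp add: sum.Sigma finite_PiE finite_planar_reps)
    also have "\<dots> = (\<Sum>(P, R, g)\<in>(SIGMA P:planar_reps S. SIGMA R:planar_reps T. increasing_maps v P R).
        Poly_Mapping.single (psubst v g P R) (c (restrict (fst \<circ> g) ?E)))"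
      using sum.reindex_bij_betw[OF bij_betw_psubst[OF S T disj],
          of "\<lambda>(f, Q). Poly_Mapping.single Q (c f)", symmetric]
      by (simp add: case_prod_unfold)
    also have "\<dots> = (\<Sum>P\<in>planar_reps S. \<Sum>R\<in>planar_reps T. \<Sum>g\<in>increasing_maps v P R.
        Poly_Mapping.single (psubst v g P R) (c (restrict (fst \<circ> g) ?E)))"
      by (simp add: sum.Sigma finite_planar_reps finite_increasing_maps)
    also have "\<dots> = (\<Sum>P\<in>planar_reps S. \<Sum>R\<in>planar_reps T. pcomp_tree lam W X v P R)"
    proof (intro sum.cong[OF refl])
      fix P R assume "P \<in> planar_reps S" "R \<in> planar_reps T"
      then have PR: "forget P = S" "forget R = T" by (simp_all add: planar_reps_def)
      have forget: "forget (psubst v g P R) = rsubst v (fst \<circ> g) S T"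
        if "\<And>c. c \<in> set (pedges v P) \<Longrightarrow> g c \<in> set (angles R)" for g
        using forget_psubst[OF distinct_plabels[OF PR(2) T] that] PR by simp
      \<comment> \<open>The planar reference composite forgets to the non-planar one, so the
        subtracted energies agree as well.\<close>
      have "(proot R, 0) \<in> set (angles R)" by (cases R) simp
      then have ref: "forget (psubst v (\<lambda>_. (proot R, 0)) P R) = rsubst v (\<lambda>_. rroot T) S T"
        using forget[of "\<lambda>_. (proot R, 0)"] PR by (auto simp: comp_def)
      have "c (restrict (fst \<circ> g) ?E) = lam ^ (?d (forget (psubst v g P R)) -
          ?d (forget (psubst v (\<lambda>_. (proot R, 0)) P R)))"
        if "g \<in> increasing_maps v P R" for g
      proof -
        have "forget (psubst v g P R) = rsubst v (fst \<circ> g) S T"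
          using that by (intro forget) (auto simp: increasing_maps_def)
        also have "\<dots> = rsubst v (restrict (fst \<circ> g) ?E) S T"
          by (rule rsubst_cong) simp
        finally show ?thesis by (simp add: c_def ref)
      qed
      then show "(\<Sum>g\<in>increasing_maps v P R.
          Poly_Mapping.single (psubst v g P R) (c (restrict (fst \<circ> g) ?E))) = pcomp_tree lam W X v P R"
        using True PR set_plabels[OF PR(2)]
        by (simp add: pcomp_tree_def pweight_eq penergy_eq Let_def)
    qed
    finally show ?thesis by (simp add: bilin)
  qed
qed


section \<open>Relabelling\<close>

lemma forget_map_ptree: "forget (map_ptree \<rho> P) = map_rtree \<rho> (forget P)"
proof (induction P)
  case (PNode a Ps)
  have "{#forget (map_ptree \<rho> P). P \<in># mset Ps#} = {#map_rtree \<rho> (forget P). P \<in># mset Ps#}"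
    by (rule image_mset_cong) (simp add: PNode)
  then show ?case by (simp add: image_mset.compositionality comp_def)
qed

lemma set_ptree_eq: "set_ptree P = set (plabels P)"
  by (induction P) auto

lemma set_rtree_eq: "set_rtree S = set_mset (rlabels S)"
  by (induction S) auto

lemma rlabels_map_rtree: "rlabels (map_rtree \<rho> S) = image_mset \<rho> (rlabels S)"
proof (induction S)
  case (RNode a M)
  then have "\<Sum>\<^sub># (image_mset (\<lambda>S. rlabels (map_rtree \<rho> S)) M) =
      image_mset \<rho> (\<Sum>\<^sub># (image_mset rlabels M))"
    by (induction M) auto
  then show ?case by (simp add: image_mset.compositionality comp_def)
qed

text \<open>An injective renaming has an inverse on the labels in use, hence carries the
  representations of \<open>S\<close> bijectively onto those of the renamed tree.\<close>

lemma sym_tree_map_rtree: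
  fixes S :: "'a rtree"
  assumes S: "nodup (rlabels S)" and inj: "inj_on \<rho> (set_mset (rlabels S))"
  shows "(sym_tree (map_rtree \<rho> S) :: 'a ptree \<Rightarrow>\<^sub>0 'k::comm_ring_1) =
    lin_ext (\<lambda>P. Poly_Mapping.single (map_ptree \<rho> P) 1) (sym_tree S)"
proof -
  let ?A = "set_mset (rlabels S)"
  let ?\<sigma> = "inv_into ?A \<rho>"
  have inv: "map_ptree ?\<sigma> (map_ptree \<rho> P) = P" if "forget P = S" for P
    unfolding ptree.map_comp using inj set_plabels[OF that]
    by (intro ptree.map_ident_strong) (simp add: set_ptree_eq)
  have "planar_reps (map_rtree \<rho> S) = map_ptree \<rho> ` planar_reps S"
  proof (intro subset_antisym subsetI)
    fix P assume "P \<in> planar_reps (map_rtree \<rho> S)"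
    then have P: "forget P = map_rtree \<rho> S" by (simp add: planar_reps_def)
    have "forget (map_ptree ?\<sigma> P) = S"
      unfolding forget_map_ptree P rtree.map_comp using inj
      by (intro rtree.map_ident_strong) (simp add: set_rtree_eq)
    moreover have "map_ptree \<rho> (map_ptree ?\<sigma> P) = P"
    proof -
      have "set_ptree P = \<rho> ` ?A"
        using set_plabels[OF P] by (simp add: set_ptree_eq rlabels_map_rtree)
      then show ?thesis
        unfolding ptree.map_comp by (intro ptree.map_ident_strong) (auto simp: f_inv_into_f)
    qed
    ultimately show "P \<in> map_ptree \<rho> ` planar_reps S"
      by (intro image_eqI[of _ _ "map_ptree ?\<sigma> P"]) (simp_all add: planar_reps_def)
  qed (auto simp: planar_reps_def forget_map_ptree)
  moreover have "inj_on (map_ptree \<rho>) (planar_reps S)"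
    by (rule inj_on_inverseI[of _ "map_ptree ?\<sigma>"]) (simp add: planar_reps_def inv)
  moreover have "nodup (rlabels (map_rtree \<rho> S))"
    using S image_mset_mset_set[OF inj] unfolding rlabels_map_rtree nodup_def
    by (metis set_image_mset)
  ultimately show ?thesis
    using S by (simp add: sym_tree_eq lin_ext_sum sum.reindex)
qed


section \<open>The morphism\<close>

lemma op_space_tree_operad:
  "x \<in> op_space (tree_operad trees mp dot cmp) A \<longleftrightarrow>
    (\<forall>W. Poly_Mapping.keys (x W) \<subseteq> trees A) \<and> (\<forall>W. W \<notin> weightings A \<longrightarrow> x W = 0)"
  by (auto simp: op_space_def tree_operad_def)

lemma lin_ext_sym_tree_bilin:
  fixes lam :: "'k::comm_ring_1"
  assumes "finite A" "finite B" "v \<in> A" "(A - {v}) \<inter> B = {}"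
    and "Poly_Mapping.keys p \<subseteq> rtrees A" "Poly_Mapping.keys q \<subseteq> rtrees B"
  shows "lin_ext sym_tree (bilin_ext (rcomp lam W X v) p q) =
    bilin_ext (pcomp_tree lam W X v) (lin_ext sym_tree p) (lin_ext sym_tree q)"
proof -
  have "lin_ext sym_tree (bilin_ext (rcomp lam W X v) p q) =
      lin_ext (\<lambda>S. lin_ext (\<lambda>T. lin_ext sym_tree (rcomp lam W X v S T)) q) p"
    by (simp add: bilin_ext_def lin_ext_lin_ext)
  also have "\<dots> = lin_ext (\<lambda>S. lin_ext (\<lambda>T. bilin_ext (pcomp_tree lam W X v) (sym_tree S) (sym_tree T)) q) p"
  proof (intro lin_ext_cong)
    fix S T assume "S \<in> Poly_Mapping.keys p" "T \<in> Poly_Mapping.keys q"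
    then have "S \<in> rtrees A" "T \<in> rtrees B" using assms by auto
    then show "lin_ext sym_tree (rcomp lam W X v S T) =
        bilin_ext (pcomp_tree lam W X v) (sym_tree S) (sym_tree T)"
      using rtrees_iff[of S A] rtrees_iff[of T B] assms by (intro sym_tree_rcomp) auto
  qed
  \<comment> \<open>The sum over representations of \<open>S\<close> has to move past the sum over
    \<open>T\<close>; this is an exchange of two linear extensions.\<close>
  also have "\<dots> = bilin_ext (pcomp_tree lam W X v) (lin_ext sym_tree p) (lin_ext sym_tree q)"
    unfolding bilin_ext_def lin_ext_lin_ext
    by (subst (2) lin_ext_swap) (simp only: lin_ext_lin_ext)
  finally show ?thesis .
qed

theorem theorem12:
  fixes lam :: "'k::field_char_0"
  shows "cp_operad_morphism
    (O_operad lam :: ('a, 'a rtree \<Rightarrow>\<^sub>0 'k, 'k) cp_operad_data)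
    (B_operad lam :: ('a, 'a ptree \<Rightarrow>\<^sub>0 'k, 'k) cp_operad_data)
    symmetrization"
proof -
  let ?O = "O_operad lam :: ('a, 'a rtree \<Rightarrow>\<^sub>0 'k, 'k) cp_operad_data"
  let ?B = "B_operad lam :: ('a, 'a ptree \<Rightarrow>\<^sub>0 'k, 'k) cp_operad_data"
  have smult: "smult ?O = scale" "smult ?B = scale"
    by (simp_all add: O_operad_def B_operad_def tree_operad_def)
  have O_space: "(\<forall>W. Poly_Mapping.keys (x W) \<subseteq> rtrees A) \<and> (\<forall>W. W \<notin> weightings A \<longrightarrow> x W = 0)"
    if "x \<in> op_space ?O A" for x A
    using that by (simp add: O_operad_def op_space_tree_operad)
  have B_space: "symmetrization A x \<in> op_space ?B A" if "finite A" "x \<in> op_space ?O A" for x A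
  proof -
    have "Poly_Mapping.keys (lin_ext sym_tree (x W) :: 'a ptree \<Rightarrow>\<^sub>0 'k) \<subseteq> ptrees A" for W
      using O_space[OF that(2)] that(1) by (intro keys_lin_ext keys_sym_tree) auto
    then show ?thesis
      using O_space[OF that(2)] by (simp add: B_operad_def op_space_tree_operad symmetrization_def)
  qed
  have relabel: "symmetrization A' (relabel ?O A' s x) = relabel ?B A' s (symmetrization A x)"
    if A: "finite A" "bij_betw s A' A" and x: "x \<in> op_space ?O A" for A A' s x
  proof
    fix W' :: "'a \<Rightarrow> nat"
    let ?\<rho> = "inv_into A' s" and ?W = "restrict (W' \<circ> inv_into A' s) (s ` A')"
    \<comment> \<open>Relabelling is a right action, so trees labelled by \<open>A\<close> are
      renamed through the inverse of \<open>s\<close>.\<close>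
    have inj: "inj_on ?\<rho> A" using A(2) by (metis bij_betw_def bij_betw_inv_into)
    have "sym_tree (map_rtree ?\<rho> S) =
        lin_ext (\<lambda>P. Poly_Mapping.single (map_ptree ?\<rho> P) (1 :: 'k)) (sym_tree S)"
      if "S \<in> Poly_Mapping.keys (x ?W)" for S
    proof (rule sym_tree_map_rtree)
      have "S \<in> rtrees A" using O_space[OF x] that by blast
      from rtrees_iff[OF this A(1)] inj
      show "nodup (rlabels S)" "inj_on ?\<rho> (set_mset (rlabels S))" by auto
    qed
    then have "lin_ext sym_tree (lin_ext (\<lambda>S. Poly_Mapping.single (map_rtree ?\<rho> S) 1) (x ?W)) =
        lin_ext (\<lambda>P. Poly_Mapping.single (map_ptree ?\<rho> P) (1 :: 'k)) (lin_ext sym_tree (x ?W))"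
      unfolding lin_ext_lin_ext by (intro lin_ext_cong) simp
    then show "symmetrization A' (relabel ?O A' s x) W' = relabel ?B A' s (symmetrization A x) W'"
      by (simp add: symmetrization_def O_operad_def B_operad_def tree_operad_def)
  qed
  have pcomp: "symmetrization ((A - {v}) \<union> B) (pcomp ?O A v B x y) =
      pcomp ?B A v B (symmetrization A x) (symmetrization B y)"
    if "finite A" "finite B" "v \<in> A" "(A - {v}) \<inter> B = {}" "x \<in> op_space ?O A" "y \<in> op_space ?O B"
    for A B v x y
  proof
    fix Z
    show "symmetrization ((A - {v}) \<union> B) (pcomp ?O A v B x y) Z =
        pcomp ?B A v B (symmetrization A x) (symmetrization B y) Z"
      using O_space[OF that(5)] O_space[OF that(6)]
      by (simp add: symmetrization_def O_operad_def B_operad_def tree_operad_def Let_def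
          lin_ext_sym_tree_bilin[OF that(1-4)])
  qed
  \<comment> \<open>The fold over no branches leaves the empty word, which \<open>B_plus\<close>
    turns into the one-vertex tree.\<close>
  have unit: "symmetrization {a} (op_unit ?O a) = op_unit ?B a" for a
    by (auto simp: symmetrization_def O_operad_def B_operad_def tree_operad_def B_plus_def)
  show ?thesis
    unfolding cp_operad_morphism_def
  proof (intro conjI allI impI ballI)
    show "symmetrization A \<in> op_space ?O A \<rightarrow> op_space ?B A" if "finite A \<and> A \<noteq> {}" for A
      using B_space that by blast
    show "symmetrization A (\<lambda>W. x W + y W) = (\<lambda>W. symmetrization A x W + symmetrization A y W)"
      for A x and y :: "('a \<Rightarrow> nat) \<Rightarrow> 'a rtree \<Rightarrow>\<^sub>0 'k"
      by (simp add: symmetrization_def lin_ext_add)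
    show "symmetrization A (\<lambda>W. smult ?O c (x W)) = (\<lambda>W. smult ?B c (symmetrization A x W))" for A c x
      by (simp add: symmetrization_def smult lin_ext_scale)
    show "symmetrization A x W = symmetrization A y W" if "x W = y W"
      for A W and x y :: "('a \<Rightarrow> nat) \<Rightarrow> 'a rtree \<Rightarrow>\<^sub>0 'k"
      using that by (simp add: symmetrization_def)
  qed (use relabel pcomp unit in auto)
qed

end
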